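(* Let $A$ be a $\mathbb{Z}$-graded vector space over $\mathbb{K}$ with suspension $\uparrow A$, and let $\mu:(\uparrow A)^{\otimes 3}\to\,\uparrow A$ be a linear map of degree $1$ with $\mu\bullet\mu=0$. For every $m$ define the operator $$\delta: C^m(\uparrow A)\longrightarrow C^{m+2}(\uparrow A),\qquad \delta\varphi=\mu\bullet\varphi-(-1)^{|\varphi|}\varphi\bullet\mu$$ for homogeneous $\varphi$ of degree $|\varphi|$. Then $\delta\circ\delta=0$, i.e. $\delta$ gives complexes $\cdots\to C^m(\uparrow A)\to C^{m+2}(\uparrow A)\to\cdots$.
   Context: $\mathbb{K}$ is a field of characteristic $0$. The suspension $\uparrow A$ is the graded space obtained from $A$ by a shift of degree by one. For a $\mathbb{Z}$-graded space $W$, $C^m(W)$ denotes the space of linear maps $W^{\otimes m}\to W$; a homogeneous element $\varphi$ has a degree $|\varphi|$. For $f\in C^r(W)$, $g\in C^s(W)$ put $f\bullet_i g=f\circ(\mathrm{Id}^{\otimes(i-1)}\otimes g\otimes \mathrm{Id}^{\otimes(r-i)})\in C^{r+s-1}(W)$, with the Koszul sign convention for tensor products of graded maps ($(a\otimes b)(x\otimes y)=(-1)^{|b||x|}a(x)\otimes b(y)$), and $$f\bullet g=\sum_{i=1}^{r}(-1)^{(i-1)(s-1)}f\bullet_i g .$$ *)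

theory Defs
  imports Complex_Main "HOL-Library.Poly_Mapping"
begin

definition fscale :: "'k::field \<Rightarrow> ('b \<Rightarrow>\<^sub>0 'k) \<Rightarrow> ('b \<Rightarrow>\<^sub>0 'k)" where
  "fscale c p = Poly_Mapping.map ((*) c) p"

lemma lookup_fscale: "Poly_Mapping.lookup (fscale c p) x = c * Poly_Mapping.lookup p x"
  by (simp add: fscale_def map.rep_eq when_def)

interpretation free: vector_space "fscale :: 'k::field \<Rightarrow> ('b \<Rightarrow>\<^sub>0 'k) \<Rightarrow> ('b \<Rightarrow>\<^sub>0 'k)"
  by unfold_locales
    (auto intro!: poly_mapping_eqI simp: lookup_fscale lookup_add algebra_simps)

text \<open>The total space of the graded space is the whole type; \<open>W n\<close> is its part of degree \<open>n\<close>.\<close>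

locale graded_vector_space = vector_space scale
  for scale :: "'k::field_char_0 \<Rightarrow> 'a::ab_group_add \<Rightarrow> 'a" (infixr \<open>*s\<close> 75) +
  fixes W :: "int \<Rightarrow> 'a set"
  assumes subspace_homogeneous: "subspace (W n)"
    and direct_sum:
      "\<exists>!c. (\<forall>n. c n \<in> W n) \<and> finite {n. c n \<noteq> 0} \<and> x = (\<Sum>n | c n \<noteq> 0. c n)"

definition suspension :: "(int \<Rightarrow> 'a set) \<Rightarrow> int \<Rightarrow> 'a set" where
  "suspension A n = A (n - 1)"

context graded_vector_space
begin

definition component :: "'a \<Rightarrow> int \<Rightarrow> 'a" where
  "component x = (THE c. (\<forall>n. c n \<in> W n) \<and> finite {n. c n \<noteq> 0} \<and> x = (\<Sum>n | c n \<noteq> 0. c n))"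

text \<open>The linear map that multiplies each \<open>x \<in> W n\<close> by the Koszul sign \<open>(-1)\<^sup>d\<^sup>n\<close>.\<close>

definition koszul_sign :: "int \<Rightarrow> 'a \<Rightarrow> 'a" where
  "koszul_sign d x = (\<Sum>n | component x n \<noteq> 0. ((-1) powi (d * n)) *s component x n)"

text \<open>
  The tensor algebra is the free vector space on lists modulo the multilinearity relations;
  tensors are cosets. The \<open>m\<close>-th tensor power consists of the classes of combinations of
  lists of length \<open>m\<close>, and \<open>tensor [x\<^sub>1, \<dots>, x\<^sub>m]\<close> is \<open>x\<^sub>1 \<otimes> \<dots> \<otimes> x\<^sub>m\<close>.
\<close>

definition tensor_relations :: "('a list \<Rightarrow>\<^sub>0 'k) set" where
  "tensor_relations = free.span
     ({Poly_Mapping.single (xs @ (x + y) # ys) 1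
         - Poly_Mapping.single (xs @ x # ys) 1 - Poly_Mapping.single (xs @ y # ys) 1
         | xs x y ys. True}
      \<union> {Poly_Mapping.single (xs @ (c *s x) # ys) 1
           - fscale c (Poly_Mapping.single (xs @ x # ys) 1) | xs c x ys. True})"

definition class_of :: "('a list \<Rightarrow>\<^sub>0 'k) \<Rightarrow> ('a list \<Rightarrow>\<^sub>0 'k) set" where
  "class_of p = {q. q - p \<in> tensor_relations}"

definition rep :: "('a list \<Rightarrow>\<^sub>0 'k) set \<Rightarrow> ('a list \<Rightarrow>\<^sub>0 'k)" where
  "rep X = (SOME p. p \<in> X)"

definition free_power :: "nat \<Rightarrow> ('a list \<Rightarrow>\<^sub>0 'k) set" where
  "free_power m = {p. Poly_Mapping.keys p \<subseteq> {xs. length xs = m}}"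

definition tensor_power :: "nat \<Rightarrow> ('a list \<Rightarrow>\<^sub>0 'k) set set" where
  "tensor_power m = class_of ` free_power m"

definition tensor :: "'a list \<Rightarrow> ('a list \<Rightarrow>\<^sub>0 'k) set" where
  "tensor xs = class_of (Poly_Mapping.single xs 1)"

definition tensor_power_deg :: "nat \<Rightarrow> int \<Rightarrow> ('a list \<Rightarrow>\<^sub>0 'k) set set" where
  "tensor_power_deg m n = class_of ` free.span
     {Poly_Mapping.single xs 1 | xs ns.
        length xs = m \<and> list_all2 (\<lambda>x k. x \<in> W k) xs ns \<and> sum_list ns = n}"

definition tensor_mult ::
    "('a list \<Rightarrow>\<^sub>0 'k) set \<Rightarrow> ('a list \<Rightarrow>\<^sub>0 'k) set \<Rightarrow> ('a list \<Rightarrow>\<^sub>0 'k) set" where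
  "tensor_mult X Y = class_of
     (\<Sum>xs\<in>Poly_Mapping.keys (rep X). \<Sum>ys\<in>Poly_Mapping.keys (rep Y).
        Poly_Mapping.single (xs @ ys)
          (Poly_Mapping.lookup (rep X) xs * Poly_Mapping.lookup (rep Y) ys))"

text \<open>
  The linear map on the \<open>n\<close>-th tensor power that sends \<open>tensor xs\<close> to \<open>F xs\<close>, for \<open>F\<close> that is
  multilinear on lists of length \<open>n\<close>.
\<close>

definition extend ::
    "nat \<Rightarrow> ('a list \<Rightarrow> ('a list \<Rightarrow>\<^sub>0 'k) set) \<Rightarrow> ('a list \<Rightarrow>\<^sub>0 'k) set \<Rightarrow> ('a list \<Rightarrow>\<^sub>0 'k) set" where
  "extend n F X =
     (let p = (SOME p. p \<in> X \<and> p \<in> free_power n)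
      in class_of (\<Sum>xs\<in>Poly_Mapping.keys p. fscale (Poly_Mapping.lookup p xs) (rep (F xs))))"

text \<open>
  For \<open>a\<close> defined on the \<open>p\<close>-th and \<open>b\<close> of degree \<open>d\<close> defined on the \<open>q\<close>-th tensor power, this is
  \<open>a \<otimes> b\<close>: the sign \<open>(-1)\<^sup>d\<^sup>|\<^sup>x\<^sup>|\<close> in \<open>(a \<otimes> b) (x \<otimes> y)\<close> is the product of the signs of the factors
  of \<open>x\<close>.
\<close>

definition tensor_maps ::
    "nat \<Rightarrow> nat \<Rightarrow> int
     \<Rightarrow> (('a list \<Rightarrow>\<^sub>0 'k) set \<Rightarrow> ('a list \<Rightarrow>\<^sub>0 'k) set)
     \<Rightarrow> (('a list \<Rightarrow>\<^sub>0 'k) set \<Rightarrow> ('a list \<Rightarrow>\<^sub>0 'k) set)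
     \<Rightarrow> ('a list \<Rightarrow>\<^sub>0 'k) set \<Rightarrow> ('a list \<Rightarrow>\<^sub>0 'k) set" where
  "tensor_maps p q d a b = extend (p + q)
     (\<lambda>xs. tensor_mult (a (tensor (map (koszul_sign d) (take p xs)))) (b (tensor (drop p xs))))"

text \<open>
  Linear maps from the \<open>m\<close>-th tensor power to the space itself. They are set to \<open>0\<close> outside
  the tensor power, so that equality of functions is equality of maps.
\<close>

definition cochains :: "nat \<Rightarrow> (('a list \<Rightarrow>\<^sub>0 'k) set \<Rightarrow> 'a) set" where
  "cochains m = {f.
     (\<forall>p\<in>free_power m. \<forall>q\<in>free_power m.
        f (class_of (p + q)) = f (class_of p) + f (class_of q)) \<and>
     (\<forall>c. \<forall>p\<in>free_power m. f (class_of (fscale c p)) = c *s f (class_of p)) \<and>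
     (\<forall>X. X \<notin> tensor_power m \<longrightarrow> f X = 0)}"

definition cochains_deg :: "nat \<Rightarrow> int \<Rightarrow> (('a list \<Rightarrow>\<^sub>0 'k) set \<Rightarrow> 'a) set" where
  "cochains_deg m d = {f \<in> cochains m. \<forall>n. \<forall>X\<in>tensor_power_deg m n. f X \<in> W (n + d)}"

text \<open>
  \<open>f \<bullet>\<^sub>i g\<close> and \<open>f \<bullet> g\<close> for cochains \<open>f\<close>, \<open>g\<close> of arities \<open>r\<close>, \<open>s\<close>, where \<open>g\<close> is homogeneous of
  degree \<open>d\<close>. The values of \<open>g\<close> are read as tensors of length one.
\<close>

definition circ_at ::
    "nat \<Rightarrow> nat \<Rightarrow> int \<Rightarrow> nat \<Rightarrow> (('a list \<Rightarrow>\<^sub>0 'k) set \<Rightarrow> 'a) \<Rightarrow> (('a list \<Rightarrow>\<^sub>0 'k) set \<Rightarrow> 'a)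
     \<Rightarrow> ('a list \<Rightarrow>\<^sub>0 'k) set \<Rightarrow> 'a" where
  "circ_at r s d i f g X =
     (if X \<in> tensor_power (r + s - 1)
      then f (tensor_maps (i - 1) (s + (r - i)) d id
                (tensor_maps s (r - i) 0 (\<lambda>Y. tensor [g Y]) id) X)
      else 0)"

definition circ ::
    "nat \<Rightarrow> nat \<Rightarrow> int \<Rightarrow> (('a list \<Rightarrow>\<^sub>0 'k) set \<Rightarrow> 'a) \<Rightarrow> (('a list \<Rightarrow>\<^sub>0 'k) set \<Rightarrow> 'a)
     \<Rightarrow> ('a list \<Rightarrow>\<^sub>0 'k) set \<Rightarrow> 'a" where
  "circ r s d f g X =
     (\<Sum>i = 1..r. ((-1) powi ((int i - 1) * (int s - 1))) *s circ_at r s d i f g X)"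

text \<open>
  The homogeneous components of a cochain. There may be infinitely many nonzero ones,
  but only finitely many are nonzero on a given tensor.
\<close>

definition cochain_component ::
    "nat \<Rightarrow> (('a list \<Rightarrow>\<^sub>0 'k) set \<Rightarrow> 'a) \<Rightarrow> int \<Rightarrow> ('a list \<Rightarrow>\<^sub>0 'k) set \<Rightarrow> 'a" where
  "cochain_component m f = (THE c.
     (\<forall>d. c d \<in> cochains_deg m d) \<and>
     (\<forall>X. finite {d. c d X \<noteq> 0} \<and> f X = (\<Sum>d | c d X \<noteq> 0. c d X)))"

text \<open>
  The operator \<open>\<delta>\<close> given by a ternary cochain \<open>\<mu>\<close> of degree \<open>1\<close>: first on cochains of arity \<open>m\<close> that are
  homogeneous of degree \<open>d\<close>, then on all cochains of arity \<open>m\<close> by summing over their components.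
\<close>

definition differential_deg ::
    "(('a list \<Rightarrow>\<^sub>0 'k) set \<Rightarrow> 'a) \<Rightarrow> nat \<Rightarrow> int \<Rightarrow> (('a list \<Rightarrow>\<^sub>0 'k) set \<Rightarrow> 'a)
     \<Rightarrow> ('a list \<Rightarrow>\<^sub>0 'k) set \<Rightarrow> 'a" where
  "differential_deg \<mu> m d \<phi> X = circ 3 m d \<mu> \<phi> X - ((-1) powi d) *s circ m 3 1 \<phi> \<mu> X"

definition differential ::
    "(('a list \<Rightarrow>\<^sub>0 'k) set \<Rightarrow> 'a) \<Rightarrow> nat \<Rightarrow> (('a list \<Rightarrow>\<^sub>0 'k) set \<Rightarrow> 'a)
     \<Rightarrow> ('a list \<Rightarrow>\<^sub>0 'k) set \<Rightarrow> 'a" where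
  "differential \<mu> m \<phi> X =
     (\<Sum>d | differential_deg \<mu> m d (cochain_component m \<phi> d) X \<noteq> 0.
        differential_deg \<mu> m d (cochain_component m \<phi> d) X)"

end

end

theory Submission
  imports Defs
begin

text \<open>
  A cochain is determined by its values on the pure tensors \<open>x\<^sub>1 \<otimes> \<dots> \<otimes> x\<^sub>m\<close>, even on those with
  homogeneous factors, so every identity of cochains is checked on lists. Splitting
  \<open>(f \<bullet> g) \<bullet> h\<close> by the position of \<open>h\<close> relative to \<open>g\<close> gives \<open>f \<bullet> (g \<bullet> h)\<close> plus terms in which
  \<open>g\<close> and \<open>h\<close> enter different slots of \<open>f\<close>; up to the sign \<open>(-1)\<close> to the power
  \<open>|g||h| + (s - 1)(t - 1)\<close> these terms are symmetric in \<open>g\<close> and \<open>h\<close>, where \<open>s\<close>, \<open>t\<close> are the arities of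
  \<open>g\<close>, \<open>h\<close>. This graded pre-Lie identity with \<open>f = \<phi>\<close>, \<open>g = h = \<mu>\<close> gives \<open>(\<phi> \<bullet> \<mu>) \<bullet> \<mu> = 0\<close> in
  characteristic \<open>0\<close>, and with \<open>f = h = \<mu>\<close>, \<open>g = \<phi>\<close> it cancels the remaining three terms of
  \<open>\<delta> (\<delta> \<phi>)\<close>. A cochain that is not homogeneous is reduced to its components, since \<open>\<delta>\<close> shifts the
  degree by one.
\<close>

section \<open>Linear extension and tensors\<close>

text \<open>The scalar multiplication is a parameter because the construction is used with two
  targets: the free space on lists (\<open>fscale\<close>) and the graded space itself
  (\<open>scale\<close>).\<close>

definition linear_extension ::
    "('k::field \<Rightarrow> 'b::ab_group_add \<Rightarrow> 'b) \<Rightarrow> ('c \<Rightarrow> 'b) \<Rightarrow> ('c \<Rightarrow>\<^sub>0 'k) \<Rightarrow> 'b" where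
  "linear_extension scl F p =
     (\<Sum>u\<in>Poly_Mapping.keys p. scl (Poly_Mapping.lookup p u) (F u))"

lemma keys_fscale: "Poly_Mapping.keys (fscale c p) \<subseteq> Poly_Mapping.keys p"
  by (auto simp: in_keys_iff lookup_fscale)

lemma fscale_single: "fscale c (Poly_Mapping.single u a) = Poly_Mapping.single u (c * a)"
  by (rule poly_mapping_eqI) (simp add: lookup_fscale lookup_single when_def)

context vector_space
begin

lemma linear_extension_superset:
  assumes "finite S" "Poly_Mapping.keys p \<subseteq> S"
  shows "linear_extension scale F p = (\<Sum>u\<in>S. scale (Poly_Mapping.lookup p u) (F u))"
  unfolding linear_extension_def
  by (rule sum.mono_neutral_left) (use assms in \<open>auto simp: in_keys_iff\<close>)

lemma linear_extension_add:
  "linear_extension scale F (p + q) = linear_extension scale F p + linear_extension scale F q"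
proof -
  let ?S = "Poly_Mapping.keys p \<union> Poly_Mapping.keys q"
  have "finite ?S" by simp
  moreover have "Poly_Mapping.keys (p + q) \<subseteq> ?S" by (rule Poly_Mapping.keys_add)
  ultimately show ?thesis
    by (simp add: linear_extension_superset[of ?S] lookup_add scale_left_distrib sum.distrib)
qed

lemma linear_extension_fscale:
  "linear_extension scale F (fscale c p) = scale c (linear_extension scale F p)"
proof -
  have "linear_extension scale F (fscale c p)
      = (\<Sum>u\<in>Poly_Mapping.keys p. scale (Poly_Mapping.lookup (fscale c p) u) (F u))"
    by (rule linear_extension_superset) (simp_all add: keys_fscale)
  then show ?thesis
    by (simp add: lookup_fscale linear_extension_def scale_sum_right)
qed

lemma linear_extension_zero [simp]: "linear_extension scale F 0 = 0"
  by (simp add: linear_extension_def)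

lemma linear_extension_single [simp]:
  "linear_extension scale F (Poly_Mapping.single u c) = scale c (F u)"
  by (simp add: linear_extension_def)

lemma linear_extension_diff:
  "linear_extension scale F (p - q) = linear_extension scale F p - linear_extension scale F q"
proof -
  have "linear_extension scale F (p - q) + linear_extension scale F q = linear_extension scale F p"
    by (simp flip: linear_extension_add)
  then show ?thesis by (simp add: eq_diff_eq)
qed

lemma linear_extension_sum:
  "linear_extension scale F (\<Sum>i\<in>I. P i) = (\<Sum>i\<in>I. linear_extension scale F (P i))"
  by (induction I rule: infinite_finite_induct) (simp_all add: linear_extension_add)

lemma linear_extension_linear_extension:
  "linear_extension scale F (linear_extension fscale G p)
     = linear_extension scale (\<lambda>u. linear_extension scale F (G u)) p"
  by (subst (2) linear_extension_def) (simp add: linear_extension_sum linear_extension_fscale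
      linear_extension_def[of scale _ p])

lemma linear_extension_cong:
  assumes "\<And>u. u \<in> Poly_Mapping.keys p \<Longrightarrow> F u = G u"
  shows "linear_extension scale F p = linear_extension scale G p"
  unfolding linear_extension_def using assms by simp

lemma linear_extension_nonzeroE:
  assumes "linear_extension scale F p \<noteq> 0"
  obtains u where "u \<in> Poly_Mapping.keys p" "F u \<noteq> 0"
proof -
  obtain u where "u \<in> Poly_Mapping.keys p" "scale (Poly_Mapping.lookup p u) (F u) \<noteq> 0"
    using assms unfolding linear_extension_def by (rule sum.not_neutral_contains_not_neutral)
  then show thesis using that[of u] by auto
qed

lemma linear_extension_in_subspace:
  assumes "subspace S" "\<And>u. u \<in> Poly_Mapping.keys p \<Longrightarrow> F u \<in> S"
  shows "linear_extension scale F p \<in> S"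
  unfolding linear_extension_def by (intro subspace_sum subspace_scale assms)

text \<open>The preimage of a subspace under a linear map is a subspace, so testing a spanning set
  suffices. Claims about \<open>tensor_relations\<close> are reduced this way to its two kinds of
  generators.\<close>

lemma linear_extension_span:
  assumes "p \<in> free.span B" "subspace S" "\<And>b. b \<in> B \<Longrightarrow> linear_extension scale F b \<in> S"
  shows "linear_extension scale F p \<in> S"
proof -
  have "free.subspace {p. linear_extension scale F p \<in> S}"
    using assms(2) by (auto simp: free.subspace_def linear_extension_add linear_extension_fscale
        subspace_add subspace_scale subspace_0)
  then have "free.span B \<subseteq> {p. linear_extension scale F p \<in> S}"
    using assms(3) by (intro free.span_minimal) auto
  then show ?thesis using assms(1) by auto
qed

end

lemma linear_extension_basis:
  "linear_extension fscale (\<lambda>u. Poly_Mapping.single u 1) p = p"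
  by (rule poly_mapping_eqI)
    (simp add: linear_extension_def fscale_single lookup_sum lookup_single when_def in_keys_iff)

lemma minus_one_powi_cong:
  assumes "even m \<longleftrightarrow> even n"
  shows "(-1 :: 'k::field) powi m = (-1) powi n"
  using assms by (simp add: power_int_minus_left)

context graded_vector_space
begin

section \<open>The tensor algebra as a quotient by the multilinearity relations\<close>

abbreviation basis :: "'a list \<Rightarrow> ('a list \<Rightarrow>\<^sub>0 'k)" where
  "basis xs \<equiv> Poly_Mapping.single xs 1"

lemma subspace_tensor_relations: "free.subspace tensor_relations"
  unfolding tensor_relations_def by (rule free.subspace_span)

lemma tensor_relation_add:
  "basis (xs @ (x + y) # ys) - basis (xs @ x # ys) - basis (xs @ y # ys) \<in> tensor_relations"
  unfolding tensor_relations_def by (rule free.span_base) blast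

lemma tensor_relation_scale:
  "basis (xs @ (c *s x) # ys) - fscale c (basis (xs @ x # ys)) \<in> tensor_relations"
  unfolding tensor_relations_def by (rule free.span_base) blast

lemma class_of_eq_iff: "class_of p = class_of q \<longleftrightarrow> p - q \<in> tensor_relations"
proof
  assume "class_of p = class_of q"
  moreover have "p \<in> class_of p"
    by (simp add: class_of_def free.subspace_0[OF subspace_tensor_relations])
  ultimately show "p - q \<in> tensor_relations" by (simp add: class_of_def)
next
  assume *: "p - q \<in> tensor_relations"
  have "u - p \<in> tensor_relations \<longleftrightarrow> u - q \<in> tensor_relations" for u
    using free.subspace_add[OF subspace_tensor_relations _ *, of "u - p"]
      free.subspace_diff[OF subspace_tensor_relations _ *, of "u - q"]
    by auto
  then show "class_of p = class_of q" by (simp add: class_of_def)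
qed

lemma rep_class_of: "rep (class_of p) - p \<in> tensor_relations"
proof -
  have "p \<in> class_of p"
    by (simp add: class_of_def free.subspace_0[OF subspace_tensor_relations])
  then have "rep (class_of p) \<in> class_of p"
    unfolding rep_def by (rule someI)
  then show ?thesis by (simp add: class_of_def)
qed

lemma linear_extension_diff_in_relations:
  assumes "\<And>u. u \<in> Poly_Mapping.keys p \<Longrightarrow> F u - G u \<in> tensor_relations"
  shows "linear_extension fscale F p - linear_extension fscale G p \<in> tensor_relations"
proof -
  have "linear_extension fscale F p - linear_extension fscale G p
      = linear_extension fscale (\<lambda>u. F u - G u) p"
    by (simp add: linear_extension_def sum_subtractf free.scale_right_diff_distrib)
  then show ?thesis
    using assms by (simp add: free.linear_extension_in_subspace[OF subspace_tensor_relations])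
qed

text \<open>The relations form a two-sided ideal for concatenation: lengthening the words of a
  generator on either side gives a generator of the same kind.\<close>

lemma tensor_relations_append:
  assumes "p \<in> tensor_relations"
  shows "linear_extension fscale (\<lambda>u. basis (us @ u @ vs)) p \<in> tensor_relations"
  using assms unfolding tensor_relations_def
proof (rule free.linear_extension_span, fold tensor_relations_def)
  show "free.subspace tensor_relations" by (rule subspace_tensor_relations)
next
  fix b
  assume "b \<in> {basis (xs @ (x + y) # ys) - basis (xs @ x # ys) - basis (xs @ y # ys) | xs x y ys. True}
      \<union> {basis (xs @ (c *s x) # ys) - fscale c (basis (xs @ x # ys)) | xs c x ys. True}"
  then show "linear_extension fscale (\<lambda>u. basis (us @ u @ vs)) b \<in> tensor_relations"
    using tensor_relation_add[of "us @ _" _ _ "_ @ vs"] tensor_relation_scale[of "us @ _" _ _ "_ @ vs"]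
    by (auto simp: free.linear_extension_diff free.linear_extension_fscale)
qed

text \<open>\<open>tensor_mult\<close> works with arbitrary representatives. The ideal property
  exchanges that of the left factor for \<open>basis xs\<close> first, then that of the right factor
  for \<open>basis ys\<close>.\<close>

lemma tensor_mult_tensor: "tensor_mult (tensor xs) (tensor ys) = tensor (xs @ ys)"
proof -
  define p where "p = rep (tensor xs)"
  define q where "q = rep (tensor ys)"
  have p: "p - basis xs \<in> tensor_relations" and q: "q - basis ys \<in> tensor_relations"
    by (simp_all add: p_def q_def tensor_def rep_class_of)
  have "(\<Sum>u\<in>Poly_Mapping.keys p. \<Sum>v\<in>Poly_Mapping.keys q.
          Poly_Mapping.single (u @ v) (Poly_Mapping.lookup p u * Poly_Mapping.lookup q v))
      = linear_extension fscale (\<lambda>v. linear_extension fscale (\<lambda>u. basis (u @ v)) p) q"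
    by (subst sum.swap)
      (simp add: linear_extension_def free.scale_sum_right fscale_single mult.commute)
  also have "class_of \<dots> = class_of (linear_extension fscale (\<lambda>v. basis (xs @ v)) q)"
    unfolding class_of_eq_iff
    using tensor_relations_append[OF p, of "[]"]
    by (intro linear_extension_diff_in_relations) (simp add: free.linear_extension_diff)
  also have "\<dots> = class_of (basis (xs @ ys))"
    unfolding class_of_eq_iff
    using tensor_relations_append[OF q, of xs "[]"] by (simp add: free.linear_extension_diff)
  finally show ?thesis by (simp add: tensor_mult_def p_def q_def tensor_def)
qed

text \<open>The maps of tensors that occur below send words to words. They are recorded by a
  function \<open>G\<close> on lists whose multilinearity holds only modulo the relations, so that
  composing them becomes composing list functions.\<close>

definition tensor_multilinear :: "nat \<Rightarrow> ('a list \<Rightarrow> 'a list) \<Rightarrow> bool" where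
  "tensor_multilinear n G \<longleftrightarrow> (\<forall>xs x y ys c. Suc (length xs + length ys) = n \<longrightarrow>
     basis (G (xs @ (x + y) # ys)) - basis (G (xs @ x # ys)) - basis (G (xs @ y # ys))
       \<in> tensor_relations \<and>
     basis (G (xs @ (c *s x) # ys)) - fscale c (basis (G (xs @ x # ys))) \<in> tensor_relations)"

lemma subspace_free_power: "free.subspace (free_power m :: ('a list \<Rightarrow>\<^sub>0 'k) set)"
  using keys_fscale keys_add by (fastforce simp: free.subspace_def free_power_def)

lemma tensor_multilinear_relations:
  assumes "tensor_multilinear n G" "p \<in> tensor_relations" "p \<in> free_power n"
  shows "linear_extension fscale (\<lambda>u. basis (G u)) p \<in> tensor_relations"
proof -
  \<comment> \<open>All words of \<open>p\<close> have length \<open>n\<close>, but the span that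
    contains \<open>p\<close> also has generators of other lengths, where nothing is known about
    \<open>G\<close>; these are sent to 0.\<close>
  let ?H = "\<lambda>u. if length u = n then basis (G u) else 0"
  have "linear_extension fscale ?H p \<in> tensor_relations"
    using assms(2) unfolding tensor_relations_def
  proof (rule free.linear_extension_span, fold tensor_relations_def)
    show "free.subspace tensor_relations" by (rule subspace_tensor_relations)
  next
    fix b
    assume "b \<in> {basis (xs @ (x + y) # ys) - basis (xs @ x # ys) - basis (xs @ y # ys) | xs x y ys. True}
        \<union> {basis (xs @ (c *s x) # ys) - fscale c (basis (xs @ x # ys)) | xs c x ys. True}"
    then show "linear_extension fscale ?H b \<in> tensor_relations"
      using assms(1) free.subspace_0[OF subspace_tensor_relations]
      by (auto simp: free.linear_extension_diff free.linear_extension_fscale tensor_multilinear_def)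
  qed
  also have "linear_extension fscale ?H p = linear_extension fscale (\<lambda>u. basis (G u)) p"
    using assms(3) by (intro free.linear_extension_cong) (auto simp: free_power_def)
  finally show ?thesis .
qed

text \<open>\<open>extend\<close> makes two choices: a combination of words of length
  \<open>n\<close> in the class, and a representative of each value of \<open>F\<close>. Either
  choice changes the result by relations only, the first one by
  \<open>tensor_multilinear_relations\<close>.\<close>

lemma extend_class_of:
  assumes G: "tensor_multilinear n G" and F: "\<And>xs. length xs = n \<Longrightarrow> F xs = tensor (G xs)"
    and p: "p \<in> free_power n"
  shows "extend n F (class_of p) = class_of (linear_extension fscale (\<lambda>u. basis (G u)) p)"
proof -
  define q where "q = (SOME q. q \<in> class_of p \<and> q \<in> free_power n)"
  have "p \<in> class_of p \<and> p \<in> free_power n"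
    using p by (simp add: class_of_def free.subspace_0[OF subspace_tensor_relations])
  then have q: "q \<in> class_of p" "q \<in> free_power n"
    unfolding q_def by (metis (mono_tags, lifting) someI)+
  have "extend n F (class_of p) = class_of (linear_extension fscale (\<lambda>u. rep (F u)) q)"
    by (simp add: extend_def linear_extension_def q_def Let_def)
  also have "\<dots> = class_of (linear_extension fscale (\<lambda>u. basis (G u)) q)"
    unfolding class_of_eq_iff
  proof (rule linear_extension_diff_in_relations)
    fix u assume "u \<in> Poly_Mapping.keys q"
    then have "length u = n" using q(2) by (auto simp: free_power_def)
    then show "rep (F u) - basis (G u) \<in> tensor_relations"
      by (simp add: F tensor_def rep_class_of)
  qed
  also have "\<dots> = class_of (linear_extension fscale (\<lambda>u. basis (G u)) p)"
    unfolding class_of_eq_iff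
    using tensor_multilinear_relations[OF G, of "q - p"] q p
    by (simp add: free.linear_extension_diff class_of_def free.subspace_diff[OF subspace_free_power])
  finally show ?thesis .
qed

lemma basis_in_free_power [simp]: "basis xs \<in> free_power (length xs)"
  by (simp add: free_power_def)

lemma extend_tensor:
  assumes "tensor_multilinear n G" "\<And>xs. length xs = n \<Longrightarrow> F xs = tensor (G xs)" "length xs = n"
  shows "extend n F (tensor xs) = tensor (G xs)"
proof -
  have "basis xs \<in> free_power n" using assms(3) by auto
  from extend_class_of[OF assms(1,2) this] show ?thesis by (simp add: tensor_def)
qed

section \<open>Components of a vector and the Koszul sign operator\<close>

lemma component_spec:
  "(\<forall>n. component x n \<in> W n) \<and> finite {n. component x n \<noteq> 0}
     \<and> x = (\<Sum>n | component x n \<noteq> 0. component x n)"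
  unfolding component_def by (rule theI'[OF direct_sum])

lemma component_in: "component x n \<in> W n"
  using component_spec by blast

lemma finite_component: "finite {n. component x n \<noteq> 0}"
  using component_spec by blast

lemma component_sum:
  assumes "finite D" "{n. component x n \<noteq> 0} \<subseteq> D"
  shows "(\<Sum>n\<in>D. component x n) = x"
proof -
  have "(\<Sum>n\<in>D. component x n) = (\<Sum>n | component x n \<noteq> 0. component x n)"
    by (rule sum.mono_neutral_right) (use assms in auto)
  then show ?thesis using component_spec by metis
qed

lemma component_eqI:
  assumes "finite D" "\<And>n. c n \<in> W n" "{n. c n \<noteq> 0} \<subseteq> D" "x = (\<Sum>n\<in>D. c n)"
  shows "component x = c"
proof -
  have "(\<Sum>n\<in>D. c n) = (\<Sum>n | c n \<noteq> 0. c n)"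
    by (rule sum.mono_neutral_right) (use assms in auto)
  moreover have "finite {n. c n \<noteq> 0}" using assms finite_subset by blast
  ultimately show ?thesis
    unfolding component_def by (intro the1_equality direct_sum) (use assms in auto)
qed

lemma component_add: "component (x + y) n = component x n + component y n"
proof -
  let ?D = "{n. component x n \<noteq> 0} \<union> {n. component y n \<noteq> 0}"
  have D: "finite ?D" by (simp add: finite_component)
  have "component (x + y) = (\<lambda>n. component x n + component y n)"
  proof (rule component_eqI[OF D])
    show "component x n + component y n \<in> W n" for n
      by (intro subspace_add subspace_homogeneous component_in)
    show "x + y = (\<Sum>n\<in>?D. component x n + component y n)"
      using component_sum[OF D, of x] component_sum[OF D, of y] by (auto simp: sum.distrib)
  qed auto
  then show ?thesis by simp
qed

lemma component_scale: "component (c *s x) n = c *s component x n"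
proof -
  let ?D = "{n. component x n \<noteq> 0}"
  have "component (c *s x) = (\<lambda>n. c *s component x n)"
  proof (rule component_eqI[OF finite_component[of x]])
    show "c *s component x n \<in> W n" for n
      by (intro subspace_scale subspace_homogeneous component_in)
    show "c *s x = (\<Sum>n\<in>?D. c *s component x n)"
      using component_sum[OF finite_component[of x]] by (simp flip: scale_sum_right)
  qed auto
  then show ?thesis by simp
qed

lemma component_homogeneous:
  assumes "x \<in> W k"
  shows "component x n = (if n = k then x else 0)"
proof -
  have "component x = (\<lambda>n. if n = k then x else 0)"
    by (rule component_eqI[of "{k}"]) (use assms subspace_0[OF subspace_homogeneous] in auto)
  then show ?thesis by simp
qed

lemma component_zero [simp]: "component 0 n = 0"
  using component_scale[of 0 0 n] by simp

lemma koszul_sign_superset: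
  assumes "finite D" "{n. component x n \<noteq> 0} \<subseteq> D"
  shows "koszul_sign d x = (\<Sum>n\<in>D. ((-1) powi (d * n)) *s component x n)"
  unfolding koszul_sign_def by (rule sum.mono_neutral_left) (use assms in auto)

lemma koszul_sign_add: "koszul_sign d (x + y) = koszul_sign d x + koszul_sign d y"
proof -
  let ?D = "{n. component x n \<noteq> 0} \<union> {n. component y n \<noteq> 0}"
  have D: "finite ?D" by (simp add: finite_component)
  have "{n. component (x + y) n \<noteq> 0} \<subseteq> ?D" by (auto simp: component_add)
  then show ?thesis
    by (simp add: koszul_sign_superset[OF D] component_add scale_right_distrib sum.distrib)
qed

lemma koszul_sign_scale: "koszul_sign d (c *s x) = c *s koszul_sign d x"
proof -
  have "{n. component (c *s x) n \<noteq> 0} \<subseteq> {n. component x n \<noteq> 0}"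
    by (auto simp: component_scale)
  then show ?thesis
    by (simp add: koszul_sign_superset[OF finite_component[of x]] component_scale scale_sum_right
        mult.commute)
qed

lemma koszul_sign_homogeneous: "x \<in> W k \<Longrightarrow> koszul_sign d x = ((-1) powi (d * k)) *s x"
  by (subst koszul_sign_superset[of "{k}"]) (auto simp: component_homogeneous)

lemma component_koszul_sign: "component (koszul_sign d x) n = ((-1) powi (d * n)) *s component x n"
proof -
  have "component (koszul_sign d x) = (\<lambda>n. ((-1) powi (d * n)) *s component x n)"
    by (rule component_eqI[OF finite_component[of x]])
      (auto simp: koszul_sign_def intro!: subspace_scale subspace_homogeneous component_in)
  then show ?thesis by simp
qed

text \<open>The signs multiply on each component. This merges the signs of two successive insertions
  into one operator.\<close>

lemma koszul_sign_koszul_sign: "koszul_sign d (koszul_sign e x) = koszul_sign (d + e) x"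
proof -
  have "koszul_sign d (koszul_sign e x) = (\<Sum>n | component x n \<noteq> 0.
      ((-1) powi (d * n)) *s component (koszul_sign e x) n)"
    by (rule koszul_sign_superset[OF finite_component]) (auto simp: component_koszul_sign)
  also have "\<dots> = koszul_sign (d + e) x"
    by (simp add: koszul_sign_def[of "d + e"] component_koszul_sign power_int_add distrib_right)
  finally show ?thesis .
qed

lemma koszul_sign_zero [simp]: "koszul_sign 0 x = x"
  using component_sum[OF finite_component[of x]] by (simp add: koszul_sign_def)

section \<open>Tensor products of maps\<close>

lemma tensor_multilinear_append:
  assumes A: "tensor_multilinear p A" and B: "tensor_multilinear q B"
  shows "tensor_multilinear (p + q) (\<lambda>xs. A (map (koszul_sign d) (take p xs)) @ B (drop p xs))"
  unfolding tensor_multilinear_def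
proof (intro allI impI)
  fix xs ys :: "'a list" and x y c
  assume len: "Suc (length xs + length ys) = p + q"
  let ?G = "\<lambda>xs. A (map (koszul_sign d) (take p xs)) @ B (drop p xs)"
  show "basis (?G (xs @ (x + y) # ys)) - basis (?G (xs @ x # ys)) - basis (?G (xs @ y # ys))
       \<in> tensor_relations \<and>
     basis (?G (xs @ (c *s x) # ys)) - fscale c (basis (?G (xs @ x # ys))) \<in> tensor_relations"
  \<comment> \<open>The varying slot lies in the block of \<open>A\<close>, where the linear map
    \<open>koszul_sign d\<close> acts on it first, or in the block of \<open>B\<close>. The other
    block stays fixed and is attached by the ideal property.\<close>
  proof (cases "length xs < p")
    case True
    then obtain k where k: "p = length xs + Suc k" using less_imp_Suc_add by fastforce
    let ?us = "map (koszul_sign d) xs" and ?vs = "map (koszul_sign d) (take k ys)"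
    have G: "?G (xs @ z # ys) = [] @ A (?us @ koszul_sign d z # ?vs) @ B (drop k ys)" for z
      by (simp add: k)
    have "Suc (length ?us + length ?vs) = p" using len k by simp
    then have
      "basis (A (?us @ (koszul_sign d x + koszul_sign d y) # ?vs))
         - basis (A (?us @ koszul_sign d x # ?vs)) - basis (A (?us @ koszul_sign d y # ?vs))
         \<in> tensor_relations"
      "basis (A (?us @ (c *s koszul_sign d x) # ?vs)) - fscale c (basis (A (?us @ koszul_sign d x # ?vs)))
         \<in> tensor_relations"
      using A unfolding tensor_multilinear_def by blast+
    from this[THEN tensor_relations_append, of "[]" "B (drop k ys)"] show ?thesis
      unfolding G
      by (simp add: koszul_sign_add koszul_sign_scale free.linear_extension_diff
          free.linear_extension_fscale)
  next
    case False
    let ?us = "drop p xs"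
    have G: "?G (xs @ z # ys) = A (map (koszul_sign d) (take p xs)) @ B (?us @ z # ys) @ []" for z
      using False by simp
    have "Suc (length ?us + length ys) = q" using len False by simp
    then have
      "basis (B (?us @ (x + y) # ys)) - basis (B (?us @ x # ys)) - basis (B (?us @ y # ys))
         \<in> tensor_relations"
      "basis (B (?us @ (c *s x) # ys)) - fscale c (basis (B (?us @ x # ys))) \<in> tensor_relations"
      using B unfolding tensor_multilinear_def by blast+
    from this[THEN tensor_relations_append, of "A (map (koszul_sign d) (take p xs))" "[]"] show ?thesis
      unfolding G
      by (simp add: free.linear_extension_diff free.linear_extension_fscale)
  qed
qed

lemma tensor_maps_class_of:
  assumes A: "tensor_multilinear p A" "\<And>us. length us = p \<Longrightarrow> a (tensor us) = tensor (A us)"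
    and B: "tensor_multilinear q B" "\<And>us. length us = q \<Longrightarrow> b (tensor us) = tensor (B us)"
    and P: "P \<in> free_power (p + q)"
  shows "tensor_maps p q d a b (class_of P) = class_of (linear_extension fscale
     (\<lambda>xs. basis (A (map (koszul_sign d) (take p xs)) @ B (drop p xs))) P)"
  unfolding tensor_maps_def
  by (rule extend_class_of[OF tensor_multilinear_append[OF A(1) B(1)] _ P])
    (simp add: A(2) B(2) tensor_mult_tensor)

lemma tensor_maps_tensor:
  assumes A: "tensor_multilinear p A" "\<And>us. length us = p \<Longrightarrow> a (tensor us) = tensor (A us)"
    and B: "tensor_multilinear q B" "\<And>us. length us = q \<Longrightarrow> b (tensor us) = tensor (B us)"
    and "length xs = p + q"
  shows "tensor_maps p q d a b (tensor xs)
     = tensor (A (map (koszul_sign d) (take p xs)) @ B (drop p xs))"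
  unfolding tensor_maps_def
  by (rule extend_tensor[OF tensor_multilinear_append[OF A(1) B(1)] _ assms(5)])
    (simp add: A(2) B(2) tensor_mult_tensor)

section \<open>Cochains as multilinear maps\<close>

lemma map_koszul_sign_zero [simp]: "map (koszul_sign 0) xs = xs"
  by (simp add: map_idI)

definition multilinear :: "nat \<Rightarrow> ('a list \<Rightarrow> 'a) \<Rightarrow> bool" where
  "multilinear n F \<longleftrightarrow> (\<forall>xs x y ys c. Suc (length xs + length ys) = n \<longrightarrow>
     F (xs @ (x + y) # ys) = F (xs @ x # ys) + F (xs @ y # ys) \<and>
     F (xs @ (c *s x) # ys) = c *s F (xs @ x # ys))"

lemma cochain_class_of:
  assumes f: "f \<in> cochains m" and p: "p \<in> free_power m"
  shows "f (class_of p) = linear_extension scale (\<lambda>xs. f (tensor xs)) p"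
proof -
  have add: "f (class_of (p + q)) = f (class_of p) + f (class_of q)"
    if "p \<in> free_power m" "q \<in> free_power m" for p q
    using f that by (simp add: cochains_def)
  have scl: "f (class_of (fscale c p)) = c *s f (class_of p)" if "p \<in> free_power m" for c p
    using f that by (simp add: cochains_def)
  have zero: "0 \<in> free_power m" by (rule free.subspace_0[OF subspace_free_power])
  \<comment> \<open>Membership in \<open>free_power m\<close> is carried through the induction
    because \<open>f\<close> is known to be additive only there.\<close>
  have sums: "(\<Sum>u\<in>S. fscale (c u) (basis u)) \<in> free_power m \<and>
      f (class_of (\<Sum>u\<in>S. fscale (c u) (basis u))) = (\<Sum>u\<in>S. c u *s f (tensor u))"
    if "finite S" "\<forall>u\<in>S. length u = m" for S c
    using that
  proof (induction S rule: finite_induct)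
    case empty
    then show ?case using scl[OF zero, of 0] zero by simp
  next
    case (insert u S)
    have u: "basis u \<in> free_power m" "fscale (c u) (basis u) \<in> free_power m"
      using insert.prems by (auto intro: free.subspace_scale[OF subspace_free_power])
    have "fscale (c u) (basis u) + (\<Sum>u\<in>S. fscale (c u) (basis u)) \<in> free_power m"
      using insert u(2) by (intro free.subspace_add subspace_free_power) auto
    then show ?case
      using insert u by (simp add: add scl tensor_def)
  qed
  have "p = (\<Sum>u\<in>Poly_Mapping.keys p. fscale (Poly_Mapping.lookup p u) (basis u))"
    using linear_extension_basis[of p] by (simp add: linear_extension_def)
  then show ?thesis
    using sums[of "Poly_Mapping.keys p" "Poly_Mapping.lookup p"] p
    by (auto simp: free_power_def linear_extension_def)
qed

lemma cochainsI:
  assumes "\<And>p. p \<in> free_power m \<Longrightarrow> f (class_of p) = linear_extension scale F p"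
    and "\<And>X. X \<notin> tensor_power m \<Longrightarrow> f X = 0"
  shows "f \<in> cochains m"
proof -
  have "p + q \<in> free_power m" if "p \<in> free_power m" "q \<in> free_power m" for p q
    using that by (rule free.subspace_add[OF subspace_free_power])
  moreover have "fscale c p \<in> free_power m" if "p \<in> free_power m" for c p
    using that by (rule free.subspace_scale[OF subspace_free_power])
  ultimately show ?thesis
    using assms by (simp add: cochains_def linear_extension_add linear_extension_fscale)
qed

lemma cochain_outside: "f \<in> cochains m \<Longrightarrow> X \<notin> tensor_power m \<Longrightarrow> f X = 0"
  by (simp add: cochains_def)

lemma cochains_eqI:
  assumes "f \<in> cochains m" "g \<in> cochains m"
    and "\<And>xs. length xs = m \<Longrightarrow> f (tensor xs) = g (tensor xs)"
  shows "f = g"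
proof
  fix X
  show "f X = g X"
  proof (cases "X \<in> tensor_power m")
    case True
    then obtain p where p: "p \<in> free_power m" "X = class_of p"
      by (auto simp: tensor_power_def)
    moreover have "linear_extension scale (\<lambda>xs. f (tensor xs)) p
        = linear_extension scale (\<lambda>xs. g (tensor xs)) p"
      using p assms(3) by (intro linear_extension_cong) (auto simp: free_power_def)
    ultimately show ?thesis using assms by (simp add: cochain_class_of)
  next
    case False
    then show ?thesis using assms by (simp add: cochain_outside)
  qed
qed

text \<open>The congruences in \<open>tensor_multilinear\<close> are equalities of classes, and
  \<open>f\<close> is linear on classes. With \<open>G = id\<close> this reads a cochain as an
  ordinary multilinear function of lists.\<close>

lemma cochain_of_tensor_multilinear:
  assumes f: "f \<in> cochains m" and G: "tensor_multilinear n G"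
    and len: "\<And>xs. length xs = n \<Longrightarrow> length (G xs) = m"
  shows "multilinear n (\<lambda>xs. f (tensor (G xs)))"
  unfolding multilinear_def
proof (intro allI impI conjI)
  fix xs ys :: "'a list" and x y c
  assume n: "Suc (length xs + length ys) = n"
  let ?u = "\<lambda>z. basis (G (xs @ z # ys))"
  have power: "?u z \<in> free_power m" for z
    using len[of "xs @ z # ys"] n by (simp add: free_power_def)
  have power2: "?u x + ?u y \<in> free_power m" "fscale c (?u x) \<in> free_power m"
    by (intro free.subspace_add free.subspace_scale subspace_free_power power)+
  have "class_of (?u (x + y)) = class_of (?u x + ?u y)"
    using G n by (simp add: class_of_eq_iff tensor_multilinear_def flip: diff_diff_eq)
  then show "f (tensor (G (xs @ (x + y) # ys)))
      = f (tensor (G (xs @ x # ys))) + f (tensor (G (xs @ y # ys)))"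
    using cochain_class_of[OF f power2(1)] by (simp add: tensor_def linear_extension_add)
  have "class_of (?u (c *s x)) = class_of (fscale c (?u x))"
    using G n by (simp add: class_of_eq_iff tensor_multilinear_def)
  then show "f (tensor (G (xs @ (c *s x) # ys))) = c *s f (tensor (G (xs @ x # ys)))"
    using cochain_class_of[OF f power2(2)] by (simp add: tensor_def linear_extension_fscale)
qed

lemma tensor_multilinear_id: "tensor_multilinear n id"
  by (simp add: tensor_multilinear_def tensor_relation_add tensor_relation_scale)

lemma multilinear_cochain: "f \<in> cochains m \<Longrightarrow> multilinear m (\<lambda>xs. f (tensor xs))"
  using cochain_of_tensor_multilinear[OF _ tensor_multilinear_id] by simp

lemma tensor_multilinear_cochain:
  assumes "g \<in> cochains s"
  shows "tensor_multilinear s (\<lambda>us. [g (tensor us)])"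
  using multilinear_cochain[OF assms] tensor_relation_add[of "[]" _ _ "[]"]
    tensor_relation_scale[of "[]" _ _ "[]"]
  by (simp add: tensor_multilinear_def multilinear_def)

text \<open>The universal property of the tensor power. It serves to construct the homogeneous
  components of a cochain.\<close>

lemma multilinear_imp_cochain:
  assumes F: "multilinear n F"
  obtains f where "f \<in> cochains n" "\<And>xs. length xs = n \<Longrightarrow> f (tensor xs) = F xs"
proof -
  \<comment> \<open>The representative \<open>rep X\<close> may contain words of other lengths, and
    the relations among those have to be annihilated too.\<close>
  let ?H = "\<lambda>u. if length u = n then F u else 0"
  define f where "f X = (if X \<in> tensor_power n then linear_extension scale ?H (rep X) else 0)" for X
  have kill: "linear_extension scale ?H p = 0" if "p \<in> tensor_relations" for p
  proof -
    have "linear_extension scale ?H p \<in> {0}"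
      using that unfolding tensor_relations_def
    proof (rule linear_extension_span)
      fix b
      assume "b \<in> {basis (xs @ (x + y) # ys) - basis (xs @ x # ys) - basis (xs @ y # ys) | xs x y ys. True}
          \<union> {basis (xs @ (c *s x) # ys) - fscale c (basis (xs @ x # ys)) | xs c x ys. True}"
      then show "linear_extension scale ?H b \<in> {0}"
        using F by (auto simp: linear_extension_diff linear_extension_fscale multilinear_def)
    qed (simp add: subspace_def)
    then show ?thesis by simp
  qed
  have val: "f (class_of p) = linear_extension scale ?H p" if "p \<in> free_power n" for p
    using kill[OF rep_class_of[of p]] that
    by (simp add: f_def tensor_power_def linear_extension_diff)
  have "f \<in> cochains n"
    by (rule cochainsI[OF val]) (simp_all add: f_def)
  moreover have "f (tensor xs) = F xs" if "length xs = n" for xs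
    using val[of "basis xs"] basis_in_free_power[of xs] that by (simp add: tensor_def)
  ultimately show thesis using that by blast
qed

section \<open>Inserting one cochain into a slot of another\<close>

definition insert_at :: "int \<Rightarrow> nat \<Rightarrow> nat \<Rightarrow> ('a list \<Rightarrow> 'a) \<Rightarrow> 'a list \<Rightarrow> 'a list" where
  "insert_at d s i g xs = map (koszul_sign d) (take i xs) @ g (take s (drop i xs)) # drop (i + s) xs"

lemma length_insert_at [simp]:
  "length xs = r + s - 1 \<Longrightarrow> i < r \<Longrightarrow> length (insert_at d s i g xs) = r"
  by (auto simp: insert_at_def)

text \<open>The two nested \<open>tensor_maps\<close> collapse to one operation on lists. The inner
  one carries degree 0, the degree of the identity to the right of \<open>g\<close>, so signs fall
  only on the factors before \<open>g\<close>. Slots are counted from 0 in \<open>insert_at\<close>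
  and from 1 in \<open>circ_at\<close>.\<close>

lemma circ_at_class_of:
  assumes f: "f \<in> cochains r" and g: "g \<in> cochains s" and i: "i < r"
    and p: "p \<in> free_power (r + s - 1)"
  shows "circ_at r s d (Suc i) f g (class_of p)
     = linear_extension scale (\<lambda>xs. f (tensor (insert_at d s i (\<lambda>us. g (tensor us)) xs))) p"
proof -
  let ?k = "r - Suc i"
  let ?G = "insert_at d s i (\<lambda>us. g (tensor us))"
  have n: "r + s - 1 = i + (s + ?k)" using i by simp
  have inner: "tensor_maps s ?k 0 (\<lambda>Y. tensor [g Y]) id (tensor us)
      = tensor ([g (tensor (take s us))] @ drop s us)" if "length us = s + ?k" for us
    using tensor_maps_tensor[OF tensor_multilinear_cochain[OF g] _ tensor_multilinear_id _ that,
        of "\<lambda>Y. tensor [g Y]" id 0] by simp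
  have "tensor_maps i (s + ?k) d id (tensor_maps s ?k 0 (\<lambda>Y. tensor [g Y]) id) (class_of p)
      = class_of (linear_extension fscale (\<lambda>xs. basis (?G xs)) p)"
    using tensor_maps_class_of[OF tensor_multilinear_id _
        tensor_multilinear_append[OF tensor_multilinear_cochain[OF g] tensor_multilinear_id,
          where d = 0]
        _ p[unfolded n], where a = id and b = "tensor_maps s ?k 0 (\<lambda>Y. tensor [g Y]) id" and d = d] inner
    by (simp add: insert_at_def[abs_def] add.commute)
  moreover have "linear_extension fscale (\<lambda>xs. basis (?G xs)) p \<in> free_power r"
  proof (rule free.linear_extension_in_subspace)
    show "free.subspace (free_power r)" by (rule subspace_free_power)
    show "basis (?G u) \<in> free_power r" if "u \<in> Poly_Mapping.keys p" for u
      using p i that by (auto simp: free_power_def)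
  qed
  moreover have "class_of p \<in> tensor_power (r + s - 1)"
    using p by (simp add: tensor_power_def)
  ultimately show ?thesis
    by (simp add: circ_at_def cochain_class_of[OF f] linear_extension_linear_extension)
qed

lemma circ_at_tensor:
  assumes "f \<in> cochains r" "g \<in> cochains s" "i < r" "length xs = r + s - 1"
  shows "circ_at r s d (Suc i) f g (tensor xs)
     = f (tensor (insert_at d s i (\<lambda>us. g (tensor us)) xs))"
  using circ_at_class_of[OF assms(1-3), of "basis xs" d] basis_in_free_power[of xs] assms(4)
  by (simp add: tensor_def)

lemma circ_at_cochain:
  assumes "f \<in> cochains r" "g \<in> cochains s" "i < r"
  shows "circ_at r s d (Suc i) f g \<in> cochains (r + s - 1)"
  by (rule cochainsI[OF circ_at_class_of[OF assms]]) (simp_all add: circ_at_def)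

lemma cochain_zero [simp]: "(\<lambda>X. 0) \<in> cochains m"
  by (simp add: cochains_def)

lemma cochain_add: "f \<in> cochains m \<Longrightarrow> g \<in> cochains m \<Longrightarrow> (\<lambda>X. f X + g X) \<in> cochains m"
  by (simp add: cochains_def scale_right_distrib add_ac)

lemma cochain_scale: "f \<in> cochains m \<Longrightarrow> (\<lambda>X. c *s f X) \<in> cochains m"
  by (simp add: cochains_def scale_right_distrib mult.commute)

lemma cochain_diff: "f \<in> cochains m \<Longrightarrow> g \<in> cochains m \<Longrightarrow> (\<lambda>X. f X - g X) \<in> cochains m"
  by (simp add: cochains_def scale_right_diff_distrib)

lemma cochain_sum: "(\<And>i. i \<in> I \<Longrightarrow> f i \<in> cochains m) \<Longrightarrow> (\<lambda>X. \<Sum>i\<in>I. f i X) \<in> cochains m"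
  by (induction I rule: infinite_finite_induct) (simp_all add: cochain_add)

lemma circ_eq: "circ r s d f g X
    = (\<Sum>i<r. ((-1) powi (int i * (int s - 1))) *s circ_at r s d (Suc i) f g X)"
  unfolding circ_def
  by (rule sum.reindex_bij_witness[of _ Suc "\<lambda>i. i - 1"]) (auto simp: of_nat_diff)

lemma circ_cochain:
  assumes "f \<in> cochains r" "g \<in> cochains s"
  shows "circ r s d f g \<in> cochains (r + s - 1)"
  unfolding circ_eq[abs_def]
  by (intro cochain_sum cochain_scale circ_at_cochain assms) simp

lemma circ_tensor:
  assumes "f \<in> cochains r" "g \<in> cochains s" "length xs = r + s - 1"
  shows "circ r s d f g (tensor xs) = (\<Sum>i<r. ((-1) powi (int i * (int s - 1)))
     *s f (tensor (insert_at d s i (\<lambda>us. g (tensor us)) xs)))"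
  unfolding circ_eq by (rule sum.cong) (simp_all add: circ_at_tensor assms)

section \<open>Homogeneous components\<close>

lemma sum_support:
  fixes c :: "'i \<Rightarrow> 'a"
  assumes "finite D" "{d. c d \<noteq> 0} \<subseteq> D"
  shows "(\<Sum>d | c d \<noteq> 0. c d) = (\<Sum>d\<in>D. c d)"
  by (rule sum.mono_neutral_left) (use assms in auto)

abbreviation homogeneous :: "'a list \<Rightarrow> int list \<Rightarrow> bool" where
  "homogeneous \<equiv> list_all2 (\<lambda>x k. x \<in> W k)"

abbreviation lists_over :: "int set \<Rightarrow> nat \<Rightarrow> int list set" where
  "lists_over T n \<equiv> {ns. set ns \<subseteq> T \<and> length ns = n}"

section \<open>Expanding multilinear maps over homogeneous arguments\<close>

lemma multilinear_add:
  "multilinear n F \<Longrightarrow> Suc (length xs + length ys) = n \<Longrightarrow>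
    F (xs @ (x + y) # ys) = F (xs @ x # ys) + F (xs @ y # ys)"
  by (simp add: multilinear_def)

lemma multilinear_scale:
  "multilinear n F \<Longrightarrow> Suc (length xs + length ys) = n \<Longrightarrow> F (xs @ (c *s x) # ys) = c *s F (xs @ x # ys)"
  by (simp add: multilinear_def)

lemma multilinear_zero:
  assumes "multilinear n F" "length zs = n" "0 \<in> set zs"
  shows "F zs = 0"
proof -
  obtain xs ys where zs: "zs = xs @ 0 # ys" using assms(3) split_list by metis
  show ?thesis
    using multilinear_scale[OF assms(1), of xs ys 0 0] assms(2) by (simp add: zs)
qed

lemma multilinear_sum:
  assumes "multilinear n F" "Suc (length xs + length ys) = n"
  shows "F (xs @ (\<Sum>i\<in>I. c i) # ys) = (\<Sum>i\<in>I. F (xs @ c i # ys))"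
  using assms
  by (induction I rule: infinite_finite_induct) (simp_all add: multilinear_add multilinear_zero)

text \<open>Each factor is replaced by the sum of its components, slot by slot; the prefix
  \<open>us\<close> holds the slots already treated.\<close>

lemma multilinear_expand:
  assumes F: "multilinear n F" and T: "finite T"
    and "\<And>x. x \<in> set xs \<Longrightarrow> {k. component x k \<noteq> 0} \<subseteq> T" "length us + length xs = n"
  shows "F (us @ xs) = (\<Sum>ns\<in>lists_over T (length xs). F (us @ map2 component xs ns))"
  using assms(3,4)
proof (induction xs arbitrary: us)
  case Nil
  have "lists_over T 0 = {[]}" by auto
  then show ?case by simp
next
  case (Cons x xs)
  have "F (us @ x # xs) = (\<Sum>k\<in>T. F (us @ component x k # xs))"
    using multilinear_sum[OF F, of us xs "component x" T] component_sum[OF T, of x] Cons.prems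
    by simp
  also have "\<dots> = (\<Sum>k\<in>T. \<Sum>ns\<in>lists_over T (length xs). F (us @ component x k # map2 component xs ns))"
    using Cons.IH[of "us @ [component x _]"] Cons.prems by (intro sum.cong) simp_all
  also have "\<dots> = (\<Sum>(ns, k)\<in>lists_over T (length xs) \<times> T. F (us @ component x k # map2 component xs ns))"
    by (subst sum.swap) (simp add: sum.cartesian_product)
  also have "\<dots> = (\<Sum>ns\<in>lists_over T (length (x # xs)). F (us @ map2 component (x # xs) ns))"
    unfolding length_Cons lists_length_Suc_eq
    by (subst sum.reindex) (auto simp: inj_on_def intro!: sum.cong)
  finally show ?case .
qed

definition support :: "'a list \<Rightarrow> int set" where
  "support xs = (\<Union>x\<in>set xs. {k. component x k \<noteq> 0})"

lemma finite_support: "finite (support xs)"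
  by (simp add: support_def finite_component)

lemma homogeneous_components:
  "length ns = length xs \<Longrightarrow> homogeneous (map2 component xs ns) ns"
  by (auto simp: list_all2_conv_all_nth component_in)

text \<open>Both sides expand into values on lists of components, and such lists are
  homogeneous.\<close>

lemma multilinear_eqI:
  assumes F: "multilinear n F" and G: "multilinear n G"
    and eq: "\<And>xs ns. length xs = n \<Longrightarrow> homogeneous xs ns \<Longrightarrow> F xs = G xs"
    and n: "length xs = n"
  shows "F xs = G xs"
proof -
  have "F ([] @ xs) = (\<Sum>ns\<in>lists_over (support xs) (length xs). F ([] @ map2 component xs ns))"
    by (rule multilinear_expand[OF F finite_support]) (use n in \<open>auto simp: support_def\<close>)
  also have "\<dots> = (\<Sum>ns\<in>lists_over (support xs) (length xs). G ([] @ map2 component xs ns))"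
    using n by (intro sum.cong) (auto intro!: eq homogeneous_components)
  also have "\<dots> = G ([] @ xs)"
    by (rule multilinear_expand[OF G finite_support, symmetric]) (use n in \<open>auto simp: support_def\<close>)
  finally show ?thesis by simp
qed

lemma cochains_eqI_homogeneous:
  assumes "f \<in> cochains m" "g \<in> cochains m"
    and "\<And>xs ns. length xs = m \<Longrightarrow> homogeneous xs ns \<Longrightarrow> f (tensor xs) = g (tensor xs)"
  shows "f = g"
  using cochains_eqI[OF assms(1,2)]
    multilinear_eqI[OF multilinear_cochain[OF assms(1)] multilinear_cochain[OF assms(2)]] assms(3)
  by blast

text \<open>Homogeneous words span \<open>tensor_power_deg m n\<close>, and \<open>W (n + d)\<close>
  is a subspace, so the degree of a cochain can be tested on words.\<close>

lemma cochains_deg_iff: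
  "f \<in> cochains_deg m d \<longleftrightarrow> f \<in> cochains m \<and>
     (\<forall>xs ns. length xs = m \<longrightarrow> homogeneous xs ns \<longrightarrow> f (tensor xs) \<in> W (sum_list ns + d))"
  (is "?L \<longleftrightarrow> ?R")
proof
  assume L: ?L
  have "tensor xs \<in> tensor_power_deg m (sum_list ns)" if "length xs = m" "homogeneous xs ns" for xs ns
    unfolding tensor_def tensor_power_deg_def using that by (intro imageI free.span_base) blast
  then show ?R using L by (auto simp: cochains_deg_def)
next
  assume R: ?R
  have "f X \<in> W (n + d)" if X: "X \<in> tensor_power_deg m n" for n X
  proof -
    let ?B = "{basis xs | xs ns. length xs = m \<and> homogeneous xs ns \<and> sum_list ns = n}"
    obtain p where p: "p \<in> free.span ?B" "X = class_of p"
      using X unfolding tensor_power_deg_def by blast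
    have "free.span ?B \<subseteq> free_power m"
      by (intro free.span_minimal subspace_free_power) auto
    moreover have "linear_extension scale (\<lambda>xs. f (tensor xs)) p \<in> W (n + d)"
      by (rule linear_extension_span[OF p(1) subspace_homogeneous]) (use R in auto)
    ultimately show ?thesis
      using R p cochain_class_of[of f m p] by auto
  qed
  then show ?L using R by (simp add: cochains_deg_def)
qed

lemma cochains_deg_cochain: "f \<in> cochains_deg m d \<Longrightarrow> f \<in> cochains m"
  by (simp add: cochains_deg_def)

section \<open>Locally finite families of cochains\<close>

lemma locally_finite:
  assumes c: "\<And>d. c d \<in> cochains m"
    and fin: "\<And>xs. length xs = m \<Longrightarrow> finite {d. c d (tensor xs) \<noteq> 0}"
  shows "finite {d. c d X \<noteq> 0}"
proof (cases "X \<in> tensor_power m")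
  case True
  then obtain p where p: "p \<in> free_power m" "X = class_of p"
    by (auto simp: tensor_power_def)
  have "{d. c d X \<noteq> 0} \<subseteq> (\<Union>xs\<in>Poly_Mapping.keys p. {d. c d (tensor xs) \<noteq> 0})"
    by (auto simp: p cochain_class_of[OF c p(1)] elim!: linear_extension_nonzeroE)
  moreover have "finite \<dots>" using p(1) fin by (auto simp: free_power_def)
  ultimately show ?thesis by (rule finite_subset)
next
  case False
  then show ?thesis by (simp add: cochain_outside[OF c])
qed

lemma cochain_locally_finite_sum:
  assumes c: "\<And>d. c d \<in> cochains m"
    and fin: "\<And>xs. length xs = m \<Longrightarrow> finite {d. c d (tensor xs) \<noteq> 0}"
  shows "(\<lambda>X. \<Sum>d | c d X \<noteq> 0. c d X) \<in> cochains m"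
proof (rule cochainsI)
  fix p assume p: "p \<in> free_power m"
  \<comment> \<open>A class involves finitely many words, so one finite index set serves all of them
    and the two sums can be exchanged.\<close>
  define D where "D = (\<Union>xs\<in>Poly_Mapping.keys p. {d. c d (tensor xs) \<noteq> 0})"
  have D: "finite D" using p fin by (auto simp: free_power_def D_def)
  have "{d. c d (class_of p) \<noteq> 0} \<subseteq> D"
    by (auto simp: D_def cochain_class_of[OF c p] elim!: linear_extension_nonzeroE)
  then have "(\<Sum>d | c d (class_of p) \<noteq> 0. c d (class_of p))
      = (\<Sum>d\<in>D. linear_extension scale (\<lambda>xs. c d (tensor xs)) p)"
    by (simp add: sum_support[OF D] cochain_class_of[OF c p])
  also have "\<dots> = linear_extension scale (\<lambda>xs. \<Sum>d\<in>D. c d (tensor xs)) p"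
    by (simp add: linear_extension_def scale_sum_right sum.swap[of _ D])
  also have "\<dots> = linear_extension scale (\<lambda>xs. \<Sum>d | c d (tensor xs) \<noteq> 0. c d (tensor xs)) p"
    by (intro linear_extension_cong sum_support[OF D, symmetric]) (auto simp: D_def)
  finally show "(\<Sum>d | c d (class_of p) \<noteq> 0. c d (class_of p))
      = linear_extension scale (\<lambda>xs. \<Sum>d | c d (tensor xs) \<noteq> 0. c d (tensor xs)) p" .
qed (simp add: cochain_outside[OF c])

lemma multilinear_koszul_sign_homogeneous:
  assumes F: "multilinear n F" and xs: "homogeneous xs ns" and "length us + length xs = n"
  shows "F (us @ map (koszul_sign d) xs) = ((-1) powi (d * sum_list ns)) *s F (us @ xs)"
  using xs assms(3)
proof (induction xs ns arbitrary: us rule: list_all2_induct)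
  case (Cons x xs k ns)
  have "F (us @ map (koszul_sign d) (x # xs))
      = ((-1) powi (d * k)) *s F ((us @ [x]) @ map (koszul_sign d) xs)"
    using Cons.prems Cons.hyps(1)
      multilinear_scale[OF F, of us "map (koszul_sign d) xs" "(-1) powi (d * k)" x]
    by (simp add: koszul_sign_homogeneous)
  then show ?case
    using Cons.IH[of "us @ [x]"] Cons.prems by (simp add: distrib_left power_int_add)
qed simp

text \<open>On homogeneous arguments of total degree \<open>n\<close> the value of \<open>g\<close>
  has degree \<open>n + e\<close>, and the excess \<open>e\<close> produces the factor. This is the
  origin of the sign for moving two cochains past each other.\<close>

lemma koszul_sign_cochain:
  assumes g: "g \<in> cochains_deg s e" and "length xs = s"
  shows "koszul_sign d (g (tensor xs)) = ((-1) powi (d * e)) *s g (tensor (map (koszul_sign d) xs))"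
proof -
  have G: "multilinear s (\<lambda>xs. g (tensor xs))"
    by (rule multilinear_cochain[OF cochains_deg_cochain[OF g]])
  show ?thesis
  proof (rule multilinear_eqI[of s "\<lambda>xs. koszul_sign d (g (tensor xs))"
        "\<lambda>xs. ((-1) powi (d * e)) *s g (tensor (map (koszul_sign d) xs))", OF _ _ _ assms(2)])
    show "multilinear s (\<lambda>xs. koszul_sign d (g (tensor xs)))"
      using G by (simp add: multilinear_def koszul_sign_add koszul_sign_scale)
    show "multilinear s (\<lambda>xs. ((-1) powi (d * e)) *s g (tensor (map (koszul_sign d) xs)))"
      using G by (simp add: multilinear_def koszul_sign_add koszul_sign_scale scale_right_distrib
          mult.commute)
    fix xs ns assume xs: "length xs = s" "homogeneous xs ns"
    then have "g (tensor xs) \<in> W (sum_list ns + e)"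
      using g by (auto simp: cochains_deg_iff)
    then show "koszul_sign d (g (tensor xs)) = ((-1) powi (d * e)) *s g (tensor (map (koszul_sign d) xs))"
      using multilinear_koszul_sign_homogeneous[OF G xs(2), of "[]" d] xs(1)
      by (simp add: koszul_sign_homogeneous distrib_left power_int_add mult.commute)
  qed
qed

section \<open>Decomposition of a cochain: uniqueness and existence\<close>

lemma decomposition_homogeneous:
  assumes c: "\<And>d. c d \<in> cochains_deg m d"
    and f: "\<And>X. finite {d. c d X \<noteq> 0}" "\<And>X. f X = (\<Sum>d | c d X \<noteq> 0. c d X)"
    and xs: "length xs = m" "homogeneous xs ns"
  shows "c d (tensor xs) = component (f (tensor xs)) (sum_list ns + d)"
proof -
  let ?N = "sum_list ns" and ?S = "{d. c d (tensor xs) \<noteq> 0}"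
  \<comment> \<open>On arguments of total degree \<open>?N\<close> the summand \<open>c d\<close>
    takes its value in degree \<open>?N + d\<close>; distinct summands therefore land in distinct
    degrees and are forced by \<open>direct_sum\<close>.\<close>
  have "component (f (tensor xs)) = (\<lambda>n. c (n - ?N) (tensor xs))"
  proof (rule component_eqI[of "(\<lambda>d. d + ?N) ` ?S"])
    show "finite ((\<lambda>d. d + ?N) ` ?S)" using f(1) by simp
    show "c (n - ?N) (tensor xs) \<in> W n" for n
      using c[of "n - ?N"] xs by (auto simp: cochains_deg_iff dest!: spec[of _ xs] spec[of _ ns])
    show "{n. c (n - ?N) (tensor xs) \<noteq> 0} \<subseteq> (\<lambda>d. d + ?N) ` ?S"
      by (auto intro!: image_eqI[of _ _ "_ - ?N"])
    show "f (tensor xs) = (\<Sum>n\<in>(\<lambda>d. d + ?N) ` ?S. c (n - ?N) (tensor xs))"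
      by (subst sum.reindex) (auto simp: inj_on_def f(2))
  qed
  then show ?thesis by simp
qed

text \<open>Uniqueness makes the definite description computable: any decomposition that can be
  exhibited is the one denoted by \<open>cochain_component\<close>.\<close>

lemma cochain_component_eqI:
  assumes c: "\<And>d. c d \<in> cochains_deg m d"
    and f: "\<And>X. finite {d. c d X \<noteq> 0}" "\<And>X. f X = (\<Sum>d | c d X \<noteq> 0. c d X)"
  shows "cochain_component m f = c"
  unfolding cochain_component_def
proof (rule the_equality)
  fix c' assume c': "(\<forall>d. c' d \<in> cochains_deg m d) \<and>
     (\<forall>X. finite {d. c' d X \<noteq> 0} \<and> f X = (\<Sum>d | c' d X \<noteq> 0. c' d X))"
  show "c' = c"
  proof
    fix d
    show "c' d = c d"
    proof (rule cochains_eqI_homogeneous[of _ m])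
      fix xs ns assume xs: "length xs = m" "homogeneous xs ns"
      show "c' d (tensor xs) = c d (tensor xs)"
        using decomposition_homogeneous[OF c f xs, of d] decomposition_homogeneous[OF _ _ _ xs, of c' f d] c'
        by simp
    qed (use c c' in \<open>auto intro: cochains_deg_cochain\<close>)
  qed
qed (use assms in auto)

text \<open>The part of degree \<open>d\<close> of a multilinear map: on arguments of total degree
  \<open>n\<close> it keeps the component of the value in degree \<open>n + d\<close>, and it is
  extended to all lists by expanding every factor.\<close>

definition degree_part :: "('a list \<Rightarrow> 'a) \<Rightarrow> int \<Rightarrow> 'a list \<Rightarrow> 'a" where
  "degree_part F d xs = (\<Sum>ns\<in>lists_over (support xs) (length xs).
     component (F (map2 component xs ns)) (sum_list ns + d))"

text \<open>An additional tuple puts a zero component into some slot. Since \<open>support\<close>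
  depends on the list, comparing different lists requires a common index set.\<close>

lemma degree_part_superset:
  assumes F: "multilinear n F" and n: "length xs = n" and T: "finite T" "support xs \<subseteq> T"
  shows "degree_part F d xs
    = (\<Sum>ns\<in>lists_over T n. component (F (map2 component xs ns)) (sum_list ns + d))"
  unfolding degree_part_def n
proof (rule sum.mono_neutral_left)
  show "finite (lists_over T n)" using T(1) by (rule finite_lists_length_eq)
  show "lists_over (support xs) n \<subseteq> lists_over T n" using T(2) by auto
  show "\<forall>ns\<in>lists_over T n - lists_over (support xs) n.
      component (F (map2 component xs ns)) (sum_list ns + d) = 0"
  proof
    fix ns assume ns: "ns \<in> lists_over T n - lists_over (support xs) n"
    then obtain k where "k \<in> set ns" "k \<notin> support xs" by auto
    then obtain i where i: "i < n" "ns ! i \<notin> support xs"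
      using ns by (auto simp: in_set_conv_nth)
    then have "component (xs ! i) (ns ! i) = 0"
      using n by (auto simp: support_def)
    moreover have "map2 component xs ns ! i = component (xs ! i) (ns ! i)"
      using i n ns by simp
    moreover have "map2 component xs ns ! i \<in> set (map2 component xs ns)"
      using i n ns by (intro nth_mem) simp
    ultimately have "0 \<in> set (map2 component xs ns)" by metis
    then have "F (map2 component xs ns) = 0"
      using multilinear_zero[OF F] n ns by simp
    then show "component (F (map2 component xs ns)) (sum_list ns + d) = 0" by simp
  qed
qed

lemma map2_component_split:
  assumes "length ns = Suc (length xs + length ys)"
  obtains us k vs where "\<And>z. map2 component (xs @ z # ys) ns = us @ component z k # vs"
    "length us = length xs" "length vs = length ys"
proof
  let ?n = "length xs"
  have ns: "ns = take ?n ns @ ns ! ?n # drop (Suc ?n) ns"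
    using assms by (intro id_take_nth_drop) simp
  show "map2 component (xs @ z # ys) ns
      = map2 component xs (take ?n ns) @ component z (ns ! ?n) # map2 component ys (drop (Suc ?n) ns)" for z
    using assms by (subst ns) simp
qed (use assms in auto)

lemma multilinear_degree_part:
  assumes F: "multilinear n F"
  shows "multilinear n (degree_part F d)"
  unfolding multilinear_def
proof (intro allI impI)
  fix xs ys :: "'a list" and x y c
  assume n: "Suc (length xs + length ys) = n"
  \<comment> \<open>The degrees of all four vectors are included so that all the sums below run over
    the same tuples.\<close>
  define T where "T = support (xs @ x # y # (x + y) # (c *s x) # ys)"
  have T: "finite T" by (simp add: T_def finite_support)
  have part: "degree_part F d (xs @ z # ys) = (\<Sum>ns\<in>lists_over T n.
      component (F (map2 component (xs @ z # ys) ns)) (sum_list ns + d))"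
    if "z \<in> {x, y, x + y, c *s x}" for z
    by (rule degree_part_superset[OF F]) (use n that T in \<open>auto simp: support_def T_def\<close>)
  have "F (map2 component (xs @ (x + y) # ys) ns)
      = F (map2 component (xs @ x # ys) ns) + F (map2 component (xs @ y # ys) ns) \<and>
    F (map2 component (xs @ (c *s x) # ys) ns) = c *s F (map2 component (xs @ x # ys) ns)"
    if ns: "ns \<in> lists_over T n" for ns
  proof -
    obtain us k vs where "\<And>z. map2 component (xs @ z # ys) ns = us @ component z k # vs"
      "length us = length xs" "length vs = length ys"
      using map2_component_split[of ns xs ys] ns n by auto
    then show ?thesis
      using F n by (simp add: component_add component_scale multilinear_def)
  qed
  then show "degree_part F d (xs @ (x + y) # ys)
      = degree_part F d (xs @ x # ys) + degree_part F d (xs @ y # ys) \<and>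
    degree_part F d (xs @ (c *s x) # ys) = c *s degree_part F d (xs @ x # ys)"
    by (simp add: part component_add component_scale sum.distrib scale_sum_right)
qed

lemma finite_degree_part: "finite {d. degree_part F d xs \<noteq> 0}"
proof -
  \<comment> \<open>The tuple \<open>ns\<close> contributes to degree \<open>d\<close> only if its
    value has a component in degree \<open>sum_list ns + d\<close>.\<close>
  let ?S = "\<lambda>ns. (\<lambda>k. k - sum_list ns) ` {k. component (F (map2 component xs ns)) k \<noteq> 0}"
  have "{d. degree_part F d xs \<noteq> 0} \<subseteq> (\<Union>ns\<in>lists_over (support xs) (length xs). ?S ns)"
  proof
    fix d assume "d \<in> {d. degree_part F d xs \<noteq> 0}"
    then obtain ns where ns: "ns \<in> lists_over (support xs) (length xs)"
      "component (F (map2 component xs ns)) (sum_list ns + d) \<noteq> 0"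
      unfolding degree_part_def using sum.not_neutral_contains_not_neutral by blast
    then have "d \<in> ?S ns" by (intro image_eqI[of _ _ "sum_list ns + d"]) auto
    then show "d \<in> (\<Union>ns\<in>lists_over (support xs) (length xs). ?S ns)" using ns(1) by blast
  qed
  moreover have "finite \<dots>"
    using finite_lists_length_eq[OF finite_support] by (auto simp: finite_component)
  ultimately show ?thesis by (rule finite_subset)
qed

lemma sum_degree_part:
  assumes F: "multilinear n F" and n: "length xs = n"
  shows "(\<Sum>d | degree_part F d xs \<noteq> 0. degree_part F d xs) = F xs"
proof -
  let ?L = "lists_over (support xs) n"
  let ?S = "\<lambda>ns. (\<lambda>k. k - sum_list ns) ` {k. component (F (map2 component xs ns)) k \<noteq> 0}"
  \<comment> \<open>Large enough for both orders of summation: it contains every degree with a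
    nonzero part and, for each tuple, every degree to which that tuple contributes.\<close>
  define D where "D = {d. degree_part F d xs \<noteq> 0} \<union> (\<Union>ns\<in>?L. ?S ns)"
  have D: "finite D"
    using finite_lists_length_eq[OF finite_support]
    by (auto simp: D_def finite_degree_part finite_component)
  have "(\<Sum>d | degree_part F d xs \<noteq> 0. degree_part F d xs) = (\<Sum>d\<in>D. degree_part F d xs)"
    by (rule sum_support[OF D]) (simp add: D_def)
  also have "\<dots> = (\<Sum>ns\<in>?L. \<Sum>d\<in>D. component (F (map2 component xs ns)) (sum_list ns + d))"
    unfolding degree_part_def n by (rule sum.swap)
  also have "\<dots> = (\<Sum>ns\<in>?L. F (map2 component xs ns))"
  proof (rule sum.cong[OF refl])
    fix ns assume ns: "ns \<in> ?L"
    have "(\<Sum>d\<in>D. component (F (map2 component xs ns)) (sum_list ns + d))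
        = (\<Sum>k\<in>(+) (sum_list ns) ` D. component (F (map2 component xs ns)) k)"
      by (subst sum.reindex) auto
    also have "\<dots> = F (map2 component xs ns)"
    proof (rule component_sum)
      have "k - sum_list ns \<in> D" if "component (F (map2 component xs ns)) k \<noteq> 0" for k
        using ns that unfolding D_def by blast
      then show "{k. component (F (map2 component xs ns)) k \<noteq> 0} \<subseteq> (+) (sum_list ns) ` D"
        by (auto intro!: image_eqI[of _ _ "_ - sum_list ns"])
    qed (simp add: D)
    finally show "(\<Sum>d\<in>D. component (F (map2 component xs ns)) (sum_list ns + d))
      = F (map2 component xs ns)" .
  qed
  also have "\<dots> = F ([] @ xs)"
    unfolding n[symmetric]
    by (subst multilinear_expand[OF F finite_support[of xs]]) (use n in \<open>auto simp: support_def\<close>)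
  finally show ?thesis by simp
qed

text \<open>Every tuple other than \<open>ns\<close> puts a zero component into some slot, so one
  summand remains.\<close>

lemma degree_part_homogeneous:
  assumes F: "multilinear n F" and xs: "length xs = n" "homogeneous xs ns"
  shows "degree_part F d xs = component (F xs) (sum_list ns + d)"
proof -
  have nth: "xs ! i \<in> W (ns ! i)" if "i < n" for i
    using xs that by (auto simp: list_all2_conv_all_nth)
  have len: "length ns = n" using xs list_all2_lengthD by fastforce
  have "support xs \<subseteq> set ns"
  proof
    fix k assume "k \<in> support xs"
    then obtain i where i: "i < n" "component (xs ! i) k \<noteq> 0"
      using xs(1) by (auto simp: support_def in_set_conv_nth)
    then show "k \<in> set ns"
      using component_homogeneous[OF nth[of i], of k] len by (auto split: if_splits)
  qed
  then have "degree_part F d xs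
      = (\<Sum>ks\<in>lists_over (set ns) n. component (F (map2 component xs ks)) (sum_list ks + d))"
    by (intro degree_part_superset[OF F xs(1)]) auto
  also have "\<dots> = (\<Sum>ks\<in>{ns}. component (F (map2 component xs ks)) (sum_list ks + d))"
  proof (rule sum.mono_neutral_right)
    show "\<forall>ks\<in>lists_over (set ns) n - {ns}. component (F (map2 component xs ks)) (sum_list ks + d) = 0"
    proof
      fix ks assume ks: "ks \<in> lists_over (set ns) n - {ns}"
      then obtain i where i: "i < n" "ks ! i \<noteq> ns ! i"
        using len nth_equalityI[of ks ns] by auto
      then have "map2 component xs ks ! i = 0"
        using nth[of i] xs ks by (simp add: component_homogeneous)
      moreover have "map2 component xs ks ! i \<in> set (map2 component xs ks)"
        using i xs ks by (intro nth_mem) simp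
      ultimately have "0 \<in> set (map2 component xs ks)" by metis
      then show "component (F (map2 component xs ks)) (sum_list ks + d) = 0"
        using multilinear_zero[OF F] xs ks by simp
    qed
  qed (use len finite_lists_length_eq in auto)
  finally have "degree_part F d xs = component (F (map2 component xs ns)) (sum_list ns + d)"
    by simp
  moreover have "map2 component xs ns = xs"
    using nth len xs(1) by (intro nth_equalityI) (auto simp: component_homogeneous[OF nth])
  ultimately show ?thesis by simp
qed

text \<open>The degree parts become cochains by the universal property and add up to
  \<open>f\<close>; uniqueness then identifies them with \<open>cochain_component\<close>.\<close>

lemma cochain_decomposition:
  assumes f: "f \<in> cochains m"
  shows "cochain_component m f d \<in> cochains_deg m d"
    and "finite {d. cochain_component m f d X \<noteq> 0}"
    and "f X = (\<Sum>d | cochain_component m f d X \<noteq> 0. cochain_component m f d X)"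
proof -
  let ?F = "\<lambda>xs. f (tensor xs)"
  have F: "multilinear m ?F" by (rule multilinear_cochain[OF f])
  have "\<exists>c. c \<in> cochains m \<and> (\<forall>xs. length xs = m \<longrightarrow> c (tensor xs) = degree_part ?F d xs)" for d
    using multilinear_imp_cochain[OF multilinear_degree_part[OF F]] by metis
  then obtain c where c: "\<And>d. c d \<in> cochains m"
    "\<And>d xs. length xs = m \<Longrightarrow> c d (tensor xs) = degree_part ?F d xs"
    by metis
  have deg: "c d \<in> cochains_deg m d" for d
    using c(1) component_in by (auto simp: cochains_deg_iff c(2) degree_part_homogeneous[OF F])
  have fin: "finite {d. c d (tensor xs) \<noteq> 0}" if "length xs = m" for xs
    using that by (simp add: c(2) finite_degree_part)
  have "f = (\<lambda>X. \<Sum>d | c d X \<noteq> 0. c d X)"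
    by (rule cochains_eqI[OF f cochain_locally_finite_sum[OF c(1) fin]])
      (simp_all add: c(2) sum_degree_part[OF F])
  then have sums: "f X = (\<Sum>d | c d X \<noteq> 0. c d X)" for X by metis
  have fin': "finite {d. c d X \<noteq> 0}" for X by (rule locally_finite[OF c(1) fin])
  have "cochain_component m f = c"
    by (rule cochain_component_eqI[OF deg fin' sums])
  then show "cochain_component m f d \<in> cochains_deg m d"
    "finite {d. cochain_component m f d X \<noteq> 0}"
    "f X = (\<Sum>d | cochain_component m f d X \<noteq> 0. cochain_component m f d X)"
    using deg fin' sums by simp_all
qed

section \<open>The pre-Lie identity\<close>

lemma cochains_deg_scale: "f \<in> cochains_deg m d \<Longrightarrow> (\<lambda>X. c *s f X) \<in> cochains_deg m d"
  by (auto simp: cochains_deg_iff intro: cochain_scale subspace_scale[OF subspace_homogeneous])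

lemma cochains_deg_diff:
  "f \<in> cochains_deg m d \<Longrightarrow> g \<in> cochains_deg m d \<Longrightarrow> (\<lambda>X. f X - g X) \<in> cochains_deg m d"
  by (auto simp: cochains_deg_iff intro: cochain_diff subspace_diff[OF subspace_homogeneous])

lemma cochains_deg_add:
  "f \<in> cochains_deg m d \<Longrightarrow> g \<in> cochains_deg m d \<Longrightarrow> (\<lambda>X. f X + g X) \<in> cochains_deg m d"
  by (auto simp: cochains_deg_iff intro: cochain_add subspace_add[OF subspace_homogeneous])

lemma homogeneous_insert_at:
  assumes g: "g \<in> cochains_deg s e" and xs: "homogeneous xs ns" "i + s \<le> length xs"
  shows "homogeneous (insert_at d s i (\<lambda>us. g (tensor us)) xs)
    (take i ns @ (sum_list (take s (drop i ns)) + e) # drop (i + s) ns)"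
  unfolding insert_at_def
proof (intro list_all2_appendI list_all2_Cons[THEN iffD2] conjI list_all2_dropI xs)
  show "homogeneous (map (koszul_sign d) (take i xs)) (take i ns)"
    using list_all2_takeI[OF xs(1), of i]
    by (auto simp: list_all2_map1 koszul_sign_homogeneous subspace_scale[OF subspace_homogeneous]
        elim!: list_all2_mono)
  show "g (tensor (take s (drop i xs))) \<in> W (sum_list (take s (drop i ns)) + e)"
    using g xs list_all2_takeI[OF list_all2_dropI[OF xs(1), of i], of s]
    by (auto simp: cochains_deg_iff)
qed

lemma circ_cochains_deg:
  assumes f: "f \<in> cochains_deg r d" and g: "g \<in> cochains_deg s e"
  shows "circ r s e f g \<in> cochains_deg (r + s - 1) (d + e)"
  unfolding cochains_deg_iff
proof (intro conjI allI impI)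
  note fg = cochains_deg_cochain[OF f] cochains_deg_cochain[OF g]
  show "circ r s e f g \<in> cochains (r + s - 1)" by (rule circ_cochain[OF fg])
  fix xs ns assume xs: "length xs = r + s - 1" "homogeneous xs ns"
  show "circ r s e f g (tensor xs) \<in> W (sum_list ns + (d + e))"
    unfolding circ_tensor[OF fg xs(1)]
  proof (intro subspace_sum[OF subspace_homogeneous] subspace_scale[OF subspace_homogeneous])
    fix i assume "i \<in> {..<r}"
    then have i: "i < r" "i + s \<le> length xs" using xs(1) by auto
    have "sum_list ns = sum_list (take i ns @ take s (drop i ns) @ drop (i + s) ns)"
      by (metis append_take_drop_id drop_drop add.commute)
    then show "f (tensor (insert_at e s i (\<lambda>us. g (tensor us)) xs)) \<in> W (sum_list ns + (d + e))"
      using f homogeneous_insert_at[OF g xs(2) i(2), of e] length_insert_at[OF xs(1) i(1)]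
      by (fastforce simp: cochains_deg_iff add_ac)
  qed
qed

section \<open>Two successive insertions\<close>

lemma split_list_lengths:
  assumes "length xs = i + (j + k)"
  obtains as bs cs where "xs = as @ bs @ cs" "length as = i" "length bs = j" "length cs = k"
proof
  show "xs = take i xs @ take j (drop i xs) @ drop j (drop i xs)" by (metis append_take_drop_id)
qed (use assms in auto)

text \<open>Here the value of \<open>h\<close> is an argument of \<open>g\<close>. Factors before
  \<open>g\<close> are passed by both maps and collect \<open>d + e\<close>; arguments of
  \<open>g\<close> before \<open>h\<close> collect only \<open>e\<close>. This is the insertion of a
  composite of arity \<open>s + t - 1\<close>.\<close>

lemma insert_at_nested:
  assumes "i \<le> j" "j < i + s" "i + s + t \<le> Suc (length xs)"
  shows "insert_at d s i g (insert_at e t j h xs)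
    = insert_at (d + e) (s + t - 1) i (\<lambda>us. g (insert_at e t (j - i) h us)) xs"
proof -
  obtain k where k: "j = i + k" using assms(1) le_Suc_ex by blast
  then obtain l where l: "s = k + Suc l" using assms(2) less_imp_Suc_add by fastforce
  obtain n where "length xs = i + (k + (t + l + n))"
    using assms(3) k l le_Suc_ex[of "i + k + t + l" "length xs"] by (auto simp: add_ac)
  \<comment> \<open>In the final splitting, \<open>as\<close> and \<open>es\<close> lie outside
    \<open>g\<close>, \<open>cs\<close> holds the arguments of \<open>h\<close>, and
    \<open>bs\<close> and \<open>ds\<close> are the other arguments of \<open>g\<close> on either
    side of \<open>h\<close>.\<close>
  then obtain as bs us where us: "xs = as @ bs @ us" "length as = i" "length bs = k"
    "length us = t + (l + n)"
    by (rule split_list_lengths) (simp add: add_ac)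
  from us(4) obtain cs ds es where "us = cs @ ds @ es" "length cs = t" "length ds = l"
    by (rule split_list_lengths)
  with us show ?thesis
    by (simp add: k l insert_at_def koszul_sign_koszul_sign)
qed

text \<open>If \<open>g\<close> is inserted last, its sign operator meets the value of
  \<open>h\<close>; if first, it meets the arguments of \<open>h\<close>. By
  \<open>koszul_sign_cochain\<close> the two differ by the given sign. Before \<open>h\<close> is
  inserted its \<open>t\<close> arguments are still separate, so \<open>g\<close> starts at position
  \<open>i + t - 1\<close>.\<close>

lemma insert_at_disjoint:
  assumes f: "f \<in> cochains r" and h: "h \<in> cochains_deg t e"
    and ji: "j < i" "i < r" and xs: "length xs + 2 = r + s + t"
  shows "f (tensor (insert_at d s i g (insert_at e t j (\<lambda>us. h (tensor us)) xs)))
    = ((-1) powi (d * e)) *s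
        f (tensor (insert_at e t j (\<lambda>us. h (tensor us)) (insert_at d s (i + t - 1) g xs)))"
proof -
  obtain k where k: "i = j + Suc k" using ji(1) less_imp_Suc_add by fastforce
  obtain n where n: "r = i + Suc n" using ji(2) less_imp_Suc_add by fastforce
  have "length xs = j + (t + (k + s + n))" using xs by (simp add: k n)
  then obtain as bs us where us: "xs = as @ bs @ us" "length as = j" "length bs = t"
    "length us = k + (s + n)"
    by (rule split_list_lengths) (simp add: add_ac)
  from us(4) obtain cs ds es where vs: "us = cs @ ds @ es" "length cs = k" "length ds = s" "length es = n"
    by (rule split_list_lengths)
  let ?as = "map (koszul_sign (d + e)) as" and ?cs = "map (koszul_sign d) cs @ g ds # es"
  have "insert_at d s i g (insert_at e t j (\<lambda>us. h (tensor us)) xs)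
      = ?as @ (((-1) powi (d * e)) *s h (tensor (map (koszul_sign d) bs))) # ?cs"
    using us vs by (simp add: k insert_at_def koszul_sign_koszul_sign koszul_sign_cochain[OF h us(3)])
  moreover have "insert_at e t j (\<lambda>us. h (tensor us)) (insert_at d s (i + t - 1) g xs)
      = ?as @ h (tensor (map (koszul_sign d) bs)) # ?cs"
    using us vs by (simp add: k insert_at_def koszul_sign_koszul_sign add.commute[of e])
  moreover have "Suc (length ?as + length ?cs) = r"
    using us vs by (simp add: k n)
  ultimately show ?thesis
    using multilinear_scale[OF multilinear_cochain[OF f]] by simp
qed

lemma cochain_insert_at_sum:
  assumes f: "f \<in> cochains r" and "i < r" "length xs = r + s - 1"
  shows "f (tensor (insert_at d s i (\<lambda>us. \<Sum>k\<in>K. c k *s G k us) xs))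
    = (\<Sum>k\<in>K. c k *s f (tensor (insert_at d s i (G k) xs)))"
proof -
  have "Suc (length (map (koszul_sign d) (take i xs)) + length (drop (i + s) xs)) = r"
    using assms by auto
  then show ?thesis
    unfolding insert_at_def
    by (simp only: multilinear_sum[OF multilinear_cochain[OF f]]
        multilinear_scale[OF multilinear_cochain[OF f]])
qed

text \<open>
  The terms of \<open>(f \<bullet> g) \<bullet> h\<close> with \<open>h\<close> to the left of \<open>g\<close>, and those with \<open>h\<close> to its right. In both,
  \<open>i\<close> and \<open>j\<close> are the slots of \<open>f\<close> that \<open>g\<close> and \<open>h\<close> fill.
\<close>

definition circ_circ_left where
  "circ_circ_left r f s d g t e h xs = (\<Sum>i<r. \<Sum>j<i.
     ((-1) powi (int i * (int s - 1) + int j * (int t - 1))) *s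
       f (tensor (insert_at d s i (\<lambda>us. g (tensor us)) (insert_at e t j (\<lambda>us. h (tensor us)) xs))))"

definition circ_circ_right where
  "circ_circ_right r f s d g t e h xs = (\<Sum>i<r. \<Sum>j\<in>{Suc i..<r}.
     ((-1) powi (int i * (int s - 1) + (int j + int s - 1) * (int t - 1))) *s
       f (tensor (insert_at d s i (\<lambda>us. g (tensor us))
                   (insert_at e t (j + s - 1) (\<lambda>us. h (tensor us)) xs))))"

text \<open>Exchanging the two sums turns the terms with \<open>h\<close> to the right of
  \<open>g\<close> into the left terms for the pair in the other order. The exponent
  \<open>d * e\<close> comes from \<open>insert_at_disjoint\<close>, and
  \<open>(s - 1) * (t - 1)\<close> from the position \<open>j + s - 1\<close> of
  \<open>h\<close>.\<close>

lemma circ_circ_right_eq: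
  assumes f: "f \<in> cochains r" and g: "g \<in> cochains_deg s d" and xs: "length xs + 2 = r + s + t"
  shows "circ_circ_right r f s d g t e h xs
    = ((-1) powi (d * e + (int s - 1) * (int t - 1))) *s circ_circ_left r f t e h s d g xs"
proof -
  let ?T = "\<lambda>i j. f (tensor (insert_at d s i (\<lambda>us. g (tensor us))
                   (insert_at e t (j + s - 1) (\<lambda>us. h (tensor us)) xs)))"
  have "circ_circ_right r f s d g t e h xs = (\<Sum>i<r. \<Sum>j\<in>{j\<in>{..<r}. i < j}.
     ((-1) powi (int i * (int s - 1) + (int j + int s - 1) * (int t - 1))) *s ?T i j)"
    unfolding circ_circ_right_def by (intro sum.cong) auto
  also have "\<dots> = (\<Sum>j<r. \<Sum>i\<in>{i\<in>{..<r}. i < j}.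
     ((-1) powi (int i * (int s - 1) + (int j + int s - 1) * (int t - 1))) *s ?T i j)"
    by (rule sum.swap_restrict) simp_all
  also have "\<dots> = (\<Sum>j<r. \<Sum>i<j.
     ((-1) powi (d * e + (int s - 1) * (int t - 1))) *s
     ((-1) powi (int j * (int t - 1) + int i * (int s - 1))) *s
       f (tensor (insert_at e t j (\<lambda>us. h (tensor us)) (insert_at d s i (\<lambda>us. g (tensor us)) xs))))"
  proof (intro sum.cong refl)
    fix i j assume j: "j \<in> {..<r}" and i: "i \<in> {..<j}"
    have "f (tensor (insert_at e t j (\<lambda>us. h (tensor us)) (insert_at d s i (\<lambda>us. g (tensor us)) xs)))
        = ((-1) powi (e * d)) *s ?T i j"
      by (rule insert_at_disjoint[OF f g]) (use i j xs in auto)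
    \<comment> \<open>The two exponents differ by \<open>2 * d * e\<close>.\<close>
    moreover have "(-1 :: 'k) powi (d * e + (int s - 1) * (int t - 1))
          * (-1) powi (int j * (int t - 1) + int i * (int s - 1)) * (-1) powi (e * d)
        = (-1) powi (int i * (int s - 1) + (int j + int s - 1) * (int t - 1))"
      by (simp flip: power_int_add) (rule minus_one_powi_cong, simp add: algebra_simps)
    ultimately show "((-1) powi (int i * (int s - 1) + (int j + int s - 1) * (int t - 1))) *s ?T i j
      = ((-1) powi (d * e + (int s - 1) * (int t - 1))) *s
     ((-1) powi (int j * (int t - 1) + int i * (int s - 1))) *s
       f (tensor (insert_at e t j (\<lambda>us. h (tensor us)) (insert_at d s i (\<lambda>us. g (tensor us)) xs)))"
      by (simp add: mult.assoc)
  qed auto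
  also have "\<dots> = ((-1) powi (d * e + (int s - 1) * (int t - 1))) *s circ_circ_left r f t e h s d g xs"
    by (simp only: circ_circ_left_def scale_sum_right)
  finally show ?thesis .
qed

lemma circ_circ:
  assumes f: "f \<in> cochains r" and g: "g \<in> cochains s" and h: "h \<in> cochains t"
    and pos: "0 < r" "0 < s + t" and xs: "length xs + 2 = r + s + t"
  shows "circ (r + s - 1) t e (circ r s d f g) h (tensor xs)
    = circ r (s + t - 1) (d + e) f (circ s t e g h) (tensor xs)
      + (circ_circ_left r f s d g t e h xs + circ_circ_right r f s d g t e h xs)"
proof -
  let ?g = "\<lambda>us. g (tensor us)" and ?h = "\<lambda>us. h (tensor us)"
  define T where "T i j = ((-1) powi (int i * (int s - 1) + int j * (int t - 1))) *s
       f (tensor (insert_at d s i ?g (insert_at e t j ?h xs)))" for i j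
  have len: "length xs = r + s - 1 + t - 1" "length xs = r + (s + t - 1) - 1"
    using xs pos by auto
  have "circ (r + s - 1) t e (circ r s d f g) h (tensor xs)
      = (\<Sum>j<r + s - 1. \<Sum>i<r. T i j)"
    unfolding circ_tensor[OF circ_cochain[OF f g] h len(1)]
  proof (rule sum.cong[OF refl])
    fix j assume "j \<in> {..<r + s - 1}"
    then have "length (insert_at e t j ?h xs) = r + s - 1"
      using length_insert_at[OF len(1)] by simp
    then show "((-1) powi (int j * (int t - 1))) *s circ r s d f g (tensor (insert_at e t j ?h xs))
        = (\<Sum>i<r. T i j)"
      by (simp add: circ_tensor[OF f g] T_def scale_sum_right power_int_add mult.commute)
  qed
  also have "\<dots> = (\<Sum>i<r. \<Sum>j<r + s - 1. T i j)" by (rule sum.swap)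
  \<comment> \<open>The position of \<open>h\<close> falls into the \<open>s\<close> arguments of
    \<open>g\<close>, before them, or after them. In the last case slot \<open>j\<close> of
    \<open>f\<close> is list position \<open>j + s - 1\<close>, because \<open>g\<close> occupies
    \<open>s\<close> positions instead of one.\<close>
  also have "\<dots> = (\<Sum>i<r. (\<Sum>k<s. T i (i + k)) + ((\<Sum>j<i. T i j) + (\<Sum>j\<in>{Suc i..<r}. T i (j + s - 1))))"
  proof (rule sum.cong[OF refl])
    fix i assume "i \<in> {..<r}"
    then have i: "i + s \<le> r + s - 1" by auto
    have "(\<Sum>j<r + s - 1. T i j) = (\<Sum>j=0..<i. T i j) + (\<Sum>j=i..<i + s. T i j) + (\<Sum>j=i + s..<r + s - 1. T i j)"
      using i by (simp add: sum.atLeastLessThan_concat lessThan_atLeast0)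
    also have "(\<Sum>j=i..<i + s. T i j) = (\<Sum>k<s. T i (i + k))"
      by (rule sum.reindex_bij_witness[of _ "\<lambda>k. i + k" "\<lambda>j. j - i"]) auto
    also have "(\<Sum>j=i + s..<r + s - 1. T i j) = (\<Sum>j\<in>{Suc i..<r}. T i (j + s - 1))"
      by (rule sum.reindex_bij_witness[of _ "\<lambda>j. j + s - 1" "\<lambda>j. j + 1 - s"]) auto
    finally show "(\<Sum>j<r + s - 1. T i j)
        = (\<Sum>k<s. T i (i + k)) + ((\<Sum>j<i. T i j) + (\<Sum>j\<in>{Suc i..<r}. T i (j + s - 1)))"
      by (simp add: lessThan_atLeast0 add_ac)
  qed
  also have "\<dots> = (\<Sum>i<r. \<Sum>k<s. T i (i + k))
      + (circ_circ_left r f s d g t e h xs + circ_circ_right r f s d g t e h xs)"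
  proof -
    have "circ_circ_right r f s d g t e h xs = (\<Sum>i<r. \<Sum>j\<in>{Suc i..<r}. T i (j + s - 1))"
      unfolding circ_circ_right_def T_def by (intro sum.cong refl) (simp add: of_nat_diff)
    then show ?thesis by (simp add: sum.distrib circ_circ_left_def T_def)
  qed
  \<comment> \<open>The nested terms: the exponent \<open>i * (s - 1) + (i + k) * (t - 1)\<close>
    regroups as \<open>i * (s + t - 2) + k * (t - 1)\<close>, the signs of the outer and of the
    inner composition.\<close>
  also have "(\<Sum>i<r. \<Sum>k<s. T i (i + k)) = circ r (s + t - 1) (d + e) f (circ s t e g h) (tensor xs)"
    unfolding circ_tensor[OF f circ_cochain[OF g h] len(2)]
  proof (rule sum.cong[OF refl])
    fix i assume "i \<in> {..<r}"
    then have i: "i < r" by simp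
    let ?G = "\<lambda>k us. g (tensor (insert_at e t k ?h us))"
    have "length (take (s + t - 1) (drop i xs)) = s + t - 1"
      using xs i pos by auto
    then have "insert_at (d + e) (s + t - 1) i (\<lambda>us. circ s t e g h (tensor us)) xs
        = insert_at (d + e) (s + t - 1) i (\<lambda>us. \<Sum>k<s. ((-1) powi (int k * (int t - 1))) *s ?G k us) xs"
      by (simp add: insert_at_def circ_tensor[OF g h])
    then have "f (tensor (insert_at (d + e) (s + t - 1) i (\<lambda>us. circ s t e g h (tensor us)) xs))
        = (\<Sum>k<s. ((-1) powi (int k * (int t - 1))) *s
            f (tensor (insert_at (d + e) (s + t - 1) i (?G k) xs)))"
      by (simp only: cochain_insert_at_sum[OF f i len(2)])
    also have "\<dots> = (\<Sum>k<s. ((-1) powi (int k * (int t - 1))) *s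
            f (tensor (insert_at d s i ?g (insert_at e t (i + k) ?h xs))))"
      using xs i by (intro sum.cong refl) (simp add: insert_at_nested)
    finally show "(\<Sum>k<s. T i (i + k)) = ((-1) powi (int i * (int (s + t - 1) - 1))) *s
        f (tensor (insert_at (d + e) (s + t - 1) i (\<lambda>us. circ s t e g h (tensor us)) xs))"
      using pos by (simp add: T_def scale_sum_right of_nat_diff algebra_simps flip: power_int_add)
  qed
  finally show ?thesis .
qed

text \<open>By \<open>circ_circ\<close> only the terms with \<open>g\<close> and \<open>h\<close> in
  different slots of \<open>f\<close> survive in each difference. They consist of the left terms for
  one order plus the sign times the left terms for the other; multiplying by the sign, whose square
  is 1, exchanges the two orders.\<close>

lemma pre_lie:
  assumes f: "f \<in> cochains r" and g: "g \<in> cochains_deg s d" and h: "h \<in> cochains_deg t e"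
    and pos: "0 < r" "0 < s + t"
  shows "circ (r + s - 1) t e (circ r s d f g) h X - circ r (s + t - 1) (d + e) f (circ s t e g h) X
    = ((-1) powi (d * e + (int s - 1) * (int t - 1))) *s
       (circ (r + t - 1) s d (circ r t e f h) g X - circ r (t + s - 1) (e + d) f (circ t s d h g) X)"
    (is "?L X = ?R X")
proof -
  note gh = cochains_deg_cochain[OF g] cochains_deg_cochain[OF h]
  let ?n = "r + s + t - 2"
  have arity: "r + s - 1 + t - 1 = ?n" "r + (s + t - 1) - 1 = ?n"
    "r + t - 1 + s - 1 = ?n" "r + (t + s - 1) - 1 = ?n"
    using pos by auto
  have "?L = ?R"
  proof (rule cochains_eqI[of _ ?n])
    show "?L \<in> cochains ?n"
      using circ_cochain[OF circ_cochain[OF f gh(1)] gh(2)] circ_cochain[OF f circ_cochain[OF gh]]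
      unfolding arity by (intro cochain_diff)
    show "?R \<in> cochains ?n"
      using circ_cochain[OF circ_cochain[OF f gh(2)] gh(1)] circ_cochain[OF f circ_cochain[OF gh(2,1)]]
      unfolding arity by (intro cochain_diff cochain_scale)
  next
    fix xs :: "'a list" assume "length xs = ?n"
    then have xs: "length xs + 2 = r + s + t" "length xs + 2 = r + t + s" using pos by auto
    let ?\<sigma> = "(-1 :: 'k) powi (d * e + (int s - 1) * (int t - 1))"
    have "?L (tensor xs) = circ_circ_left r f s d g t e h xs + ?\<sigma> *s circ_circ_left r f t e h s d g xs"
      using circ_circ[OF f gh pos xs(1)] circ_circ_right_eq[OF f g xs(1)] by simp
    also have "\<dots> = ?\<sigma> *s (circ_circ_left r f t e h s d g xs + ?\<sigma> *s circ_circ_left r f s d g t e h xs)"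
      by (simp add: scale_right_distrib)
    also have "\<dots> = ?R (tensor xs)"
      using circ_circ[OF f gh(2,1) pos(1) _ xs(2)] circ_circ_right_eq[OF f h xs(2)] pos
      by (simp add: mult.commute add.commute)
    finally show "?L (tensor xs) = ?R (tensor xs)" .
  qed
  then show ?thesis by metis
qed

section \<open>The differential\<close>

lemma circ_lincomb_left:
  "circ r s d (\<lambda>X. a *s f X + b *s f' X) g X = a *s circ r s d f g X + b *s circ r s d f' g X"
  unfolding scale_sum_right circ_def sum.distrib[symmetric]
  by (rule sum.cong) (simp_all add: circ_at_def scale_right_distrib mult.commute)

lemma circ_lincomb_right:
  assumes f: "f \<in> cochains r" and g: "g \<in> cochains s" "g' \<in> cochains s"
  shows "circ r s d f (\<lambda>X. a *s g X + b *s g' X) X = a *s circ r s d f g X + b *s circ r s d f g' X"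
proof -
  have gg: "(\<lambda>X. a *s g X + b *s g' X) \<in> cochains s"
    by (intro cochain_add cochain_scale g)
  have "circ r s d f (\<lambda>X. a *s g X + b *s g' X) = (\<lambda>X. a *s circ r s d f g X + b *s circ r s d f g' X)"
  proof (rule cochains_eqI[of _ "r + s - 1"])
    fix xs :: "'a list" assume xs: "length xs = r + s - 1"
    show "circ r s d f (\<lambda>X. a *s g X + b *s g' X) (tensor xs)
        = a *s circ r s d f g (tensor xs) + b *s circ r s d f g' (tensor xs)"
      unfolding circ_tensor[OF f gg xs] circ_tensor[OF f g(1) xs] circ_tensor[OF f g(2) xs]
        scale_sum_right sum.distrib[symmetric]
    proof (rule sum.cong[OF refl])
      fix i assume "i \<in> {..<r}"
      then have "Suc (length (map (koszul_sign d) (take i xs)) + length (drop (i + s) xs)) = r"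
        using xs by auto
      note F = multilinear_add[OF multilinear_cochain[OF f] this]
        multilinear_scale[OF multilinear_cochain[OF f] this]
      show "((-1) powi (int i * (int s - 1))) *s
            f (tensor (insert_at d s i (\<lambda>us. a *s g (tensor us) + b *s g' (tensor us)) xs))
          = a *s ((-1) powi (int i * (int s - 1))) *s f (tensor (insert_at d s i (\<lambda>us. g (tensor us)) xs))
          + b *s ((-1) powi (int i * (int s - 1))) *s f (tensor (insert_at d s i (\<lambda>us. g' (tensor us)) xs))"
        unfolding insert_at_def F by (simp add: scale_right_distrib mult.commute)
    qed
  qed (intro cochain_add cochain_scale circ_cochain f g gg)+
  then show ?thesis by metis
qed

lemma circ_zero_left: "circ r s d (\<lambda>X. 0) g X = 0"
  using circ_lincomb_left[of r s d 0 "\<lambda>X. 0" 0 "\<lambda>X. 0" g X] by simp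

lemma circ_zero_right: "f \<in> cochains r \<Longrightarrow> circ r s d f (\<lambda>X. 0) X = 0"
  using circ_lincomb_right[of f r "\<lambda>X. 0" s "\<lambda>X. 0" d 0 0 X] by simp

lemma differential_deg_lincomb:
  assumes "\<mu> \<in> cochains 3" "\<phi> \<in> cochains m" "\<psi> \<in> cochains m"
  shows "differential_deg \<mu> m d (\<lambda>X. a *s \<phi> X + b *s \<psi> X) X
    = a *s differential_deg \<mu> m d \<phi> X + b *s differential_deg \<mu> m d \<psi> X"
  unfolding differential_deg_def circ_lincomb_left circ_lincomb_right[OF assms]
  by (simp add: scale_right_distrib scale_right_diff_distrib mult.commute)

lemma differential_deg_zero:
  "\<mu> \<in> cochains 3 \<Longrightarrow> differential_deg \<mu> m d (\<lambda>X. 0) X = 0"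
  by (simp add: differential_deg_def circ_zero_left circ_zero_right)

lemma differential_deg_cochains_deg:
  assumes \<mu>: "\<mu> \<in> cochains_deg 3 1" and \<phi>: "\<phi> \<in> cochains_deg m d"
  shows "differential_deg \<mu> m d \<phi> \<in> cochains_deg (m + 2) (d + 1)"
  using cochains_deg_diff[OF circ_cochains_deg[OF \<mu> \<phi>]
      cochains_deg_scale[of _ "3 + m - 1" "1 + d" "(-1) powi d"]] circ_cochains_deg[OF \<phi> \<mu>]
  by (simp add: differential_deg_def[abs_def] add.commute)

section \<open>The square of the differential on homogeneous cochains\<close>

lemma circ_square_zero:
  assumes \<mu>: "\<mu> \<in> cochains_deg 3 1" "circ 3 3 1 \<mu> \<mu> = (\<lambda>X. 0)" and \<phi>: "\<phi> \<in> cochains m"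
  shows "circ (m + 2) 3 1 (circ m 3 1 \<phi> \<mu>) \<mu> X = 0"
\<comment> \<open>Arity 0 is separate because \<open>pre_lie\<close> requires an outer cochain of
  positive arity; here the composition is an empty sum.\<close>
proof (cases "m = 0")
  case True
  have "circ m 3 1 \<phi> \<mu> = (\<lambda>X. 0)" using True by (simp add: circ_def fun_eq_iff)
  then show ?thesis by (simp add: circ_zero_left)
next
  case False
  let ?V = "circ (m + 2) 3 1 (circ m 3 1 \<phi> \<mu>) \<mu> X"
  \<comment> \<open>For \<open>g = h = \<mu>\<close> the exponent is
    \<open>1 * 1 + 2 * 2 = 5\<close>, and the terms with \<open>\<mu> \<bullet> \<mu>\<close>
    vanish. Hence \<open>?V\<close> equals its own negative, and characteristic 0 allows division by
    2.\<close>
  have "?V = ((-1) powi 5) *s ?V"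
    using pre_lie[OF \<phi> \<mu>(1) \<mu>(1), of X] False by (simp add: \<mu>(2) circ_zero_right[OF \<phi>])
  then have "2 *s ?V = 0"
    using scale_left_distrib[of 1 1 ?V] by (simp add: eq_neg_iff_add_eq_0)
  then show ?thesis by simp
qed

lemma differential_deg_differential_deg:
  assumes \<mu>: "\<mu> \<in> cochains_deg 3 1" "circ 3 3 1 \<mu> \<mu> = (\<lambda>X. 0)" and \<phi>: "\<phi> \<in> cochains_deg m d"
  shows "differential_deg \<mu> (m + 2) (d + 1) (differential_deg \<mu> m d \<phi>) X = 0"
proof -
  note \<mu>c = cochains_deg_cochain[OF \<mu>(1)] and \<phi>c = cochains_deg_cochain[OF \<phi>]
  let ?s = "(-1 :: 'k) powi d"
  let ?A = "circ 3 m d \<mu> \<phi>" and ?B = "circ m 3 1 \<phi> \<mu>"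
  have A: "?A \<in> cochains (m + 2)" and B: "?B \<in> cochains (m + 2)"
    using circ_cochain[OF \<mu>c \<phi>c] circ_cochain[OF \<phi>c \<mu>c] by (simp_all add: add.commute)
  have D: "differential_deg \<mu> m d \<phi> = (\<lambda>X. 1 *s ?A X + (- ?s) *s ?B X)"
    by (simp add: differential_deg_def fun_eq_iff)
  \<comment> \<open>This is \<open>pre_lie\<close> with \<open>\<phi>\<close> between two copies of
    \<open>\<mu>\<close>. The arity part \<open>2 * (m - 1)\<close> of the exponent is even, so the
    sign reduces to that of \<open>d\<close>, and
    \<open>(\<mu> \<bullet> \<mu>) \<bullet> \<phi>\<close> vanishes.\<close>
  have pre: "circ (m + 2) 3 1 ?A \<mu> X - circ 3 (m + 2) (d + 1) \<mu> ?B X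
      = ?s *s (- circ 3 (m + 2) (d + 1) \<mu> ?A X)"
  proof -
    have "(-1 :: 'k) powi (d * 1 + (int m - 1) * (int 3 - 1)) = ?s"
      by (rule minus_one_powi_cong) simp
    then show ?thesis
      using pre_lie[OF \<mu>c \<phi> \<mu>(1), of X] by (simp add: \<mu>(2) circ_zero_left add.commute)
  qed
  \<comment> \<open>The outer sign, taken in degree \<open>d + 1\<close>, is \<open>- ?s\<close>;
    together with \<open>?s * ?s = 1\<close> this gives the coefficients below. Inserting
    \<open>pre\<close> cancels the first two terms, and the last vanishes by
    \<open>circ_square_zero\<close>.\<close>
  have "differential_deg \<mu> (m + 2) (d + 1) (differential_deg \<mu> m d \<phi>) X
      = circ 3 (m + 2) (d + 1) \<mu> ?A X
        + ?s *s (circ (m + 2) 3 1 ?A \<mu> X - circ 3 (m + 2) (d + 1) \<mu> ?B X)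
        - circ (m + 2) 3 1 ?B \<mu> X"
    unfolding differential_deg_def[of \<mu> "m + 2"] D circ_lincomb_left circ_lincomb_right[OF \<mu>c A B]
    by (simp add: power_int_add scale_right_distrib scale_right_diff_distrib algebra_simps)
  also have "\<dots> = 0"
    unfolding pre circ_square_zero[OF \<mu> \<phi>c] by simp
  finally show ?thesis .
qed

section \<open>The differential of an arbitrary cochain\<close>

lemma finite_differential_deg:
  assumes \<mu>: "\<mu> \<in> cochains 3" and c: "\<And>d. c d \<in> cochains m" "\<And>X. finite {d. c d X \<noteq> 0}"
    and xs: "length xs = m + 2"
  shows "finite {d. differential_deg \<mu> m d (c d) (tensor xs) \<noteq> 0}"
proof -
  \<comment> \<open>Evaluation at \<open>xs\<close> feeds only these words into \<open>c d\<close>: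
    three blocks of \<open>xs\<close>, and \<open>m\<close> words with \<open>\<mu>\<close>
    inserted. None of them depends on \<open>d\<close>, so finitely many members of the family
    contribute.\<close>
  let ?X = "\<lambda>i. tensor (take m (drop i xs))"
  let ?Y = "\<lambda>i. tensor (insert_at 1 3 i (\<lambda>us. \<mu> (tensor us)) xs)"
  have "differential_deg \<mu> m d (c d) (tensor xs) = 0"
    if X: "\<forall>i<3. c d (?X i) = 0" and Y: "\<forall>i<m. c d (?Y i) = 0" for d
  proof -
    have "\<mu> (tensor (insert_at d m i (\<lambda>us. c d (tensor us)) xs)) = 0" if "i < 3" for i
    proof (rule multilinear_zero[OF multilinear_cochain[OF \<mu>]])
      show "length (insert_at d m i (\<lambda>us. c d (tensor us)) xs) = 3"
        using that xs by (intro length_insert_at) simp_all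
      show "0 \<in> set (insert_at d m i (\<lambda>us. c d (tensor us)) xs)"
        using X that by (simp add: insert_at_def)
    qed
    then have "circ 3 m d \<mu> (c d) (tensor xs) = 0"
      using xs by (simp add: circ_tensor[OF \<mu> c(1)])
    moreover have "circ m 3 1 (c d) \<mu> (tensor xs) = 0"
      using xs Y by (simp add: circ_tensor[OF c(1) \<mu>])
    ultimately show ?thesis by (simp add: differential_deg_def)
  qed
  then have "{d. differential_deg \<mu> m d (c d) (tensor xs) \<noteq> 0}
      \<subseteq> (\<Union>i<3. {d. c d (?X i) \<noteq> 0}) \<union> (\<Union>i<m. {d. c d (?Y i) \<noteq> 0})"
    by blast
  then show ?thesis by (rule finite_subset) (auto intro: c(2))
qed

context
  fixes \<mu> m \<phi>
  assumes \<mu>: "\<mu> \<in> cochains_deg 3 1" and \<phi>: "\<phi> \<in> cochains m"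
begin

abbreviation (input) "\<delta>_part d \<equiv> differential_deg \<mu> m d (cochain_component m \<phi> d)"

lemma \<delta>_part: "\<delta>_part d \<in> cochains_deg (m + 2) (d + 1)"
  by (intro differential_deg_cochains_deg \<mu> cochain_decomposition \<phi>)

lemma finite_\<delta>_part_tensor: "length xs = m + 2 \<Longrightarrow> finite {d. \<delta>_part d (tensor xs) \<noteq> 0}"
  by (rule finite_differential_deg)
    (auto intro: cochains_deg_cochain \<mu> cochain_decomposition \<phi>)

lemma finite_\<delta>_part: "finite {d. \<delta>_part d X \<noteq> 0}"
  by (rule locally_finite[OF cochains_deg_cochain[OF \<delta>_part] finite_\<delta>_part_tensor])

lemma differential_cochain: "differential \<mu> m \<phi> \<in> cochains (m + 2)"
  unfolding differential_def[abs_def]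
  by (rule cochain_locally_finite_sum[OF cochains_deg_cochain[OF \<delta>_part] finite_\<delta>_part_tensor])

text \<open>The summand \<open>\<delta>_part d\<close> has degree \<open>d + 1\<close>, so the
  defining sum already is a homogeneous decomposition, indexed one degree lower. Thus applying the
  differential twice reduces to the homogeneous case.\<close>

lemma cochain_component_differential:
  "cochain_component (m + 2) (differential \<mu> m \<phi>) = (\<lambda>d. \<delta>_part (d - 1))"
proof (rule cochain_component_eqI)
  show "\<delta>_part (d - 1) \<in> cochains_deg (m + 2) d" for d
    using \<delta>_part[of "d - 1"] by simp
  fix X
  have shift: "{d. \<delta>_part (d - 1) X \<noteq> 0} = (\<lambda>d. d + 1) ` {d. \<delta>_part d X \<noteq> 0}"
    by (auto intro!: image_eqI[of _ _ "_ - 1"])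
  show "finite {d. \<delta>_part (d - 1) X \<noteq> 0}"
    unfolding shift by (intro finite_imageI finite_\<delta>_part)
  show "differential \<mu> m \<phi> X = (\<Sum>d | \<delta>_part (d - 1) X \<noteq> 0. \<delta>_part (d - 1) X)"
    unfolding shift by (subst sum.reindex) (simp_all add: differential_def)
qed

lemma differential_differential:
  assumes "circ 3 3 1 \<mu> \<mu> = (\<lambda>X. 0)"
  shows "differential \<mu> (m + 2) (differential \<mu> m \<phi>) X = 0"
proof -
  have "differential_deg \<mu> (m + 2) d (\<delta>_part (d - 1)) X = 0" for d
    using differential_deg_differential_deg[OF \<mu> assms cochain_decomposition(1)[OF \<phi>], of "d - 1" X]
    by simp
  then show ?thesis
    by (simp only: differential_def[of \<mu> "m + 2"] cochain_component_differential) simp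
qed

end

text \<open>\<open>cochain_component\<close> is a definite description, so its linearity has to come
  from uniqueness: combining two decompositions gives a decomposition of the combination.\<close>

lemma differential_lincomb:
  assumes \<mu>: "\<mu> \<in> cochains_deg 3 1" and \<phi>: "\<phi> \<in> cochains m" and \<psi>: "\<psi> \<in> cochains m"
  shows "differential \<mu> m (\<lambda>X. a *s \<phi> X + b *s \<psi> X) X
    = a *s differential \<mu> m \<phi> X + b *s differential \<mu> m \<psi> X"
proof -
  let ?c = "\<lambda>d X. a *s cochain_component m \<phi> d X + b *s cochain_component m \<psi> d X"
  have comp: "cochain_component m (\<lambda>X. a *s \<phi> X + b *s \<psi> X) = ?c"
  proof (rule cochain_component_eqI)
    show "?c d \<in> cochains_deg m d" for d
      by (intro cochains_deg_add cochains_deg_scale cochain_decomposition \<phi> \<psi>)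
    fix X
    let ?D = "{d. cochain_component m \<phi> d X \<noteq> 0} \<union> {d. cochain_component m \<psi> d X \<noteq> 0}"
    have D: "finite ?D" by (simp add: cochain_decomposition \<phi> \<psi>)
    have sub: "{d. ?c d X \<noteq> 0} \<subseteq> ?D" by auto
    then show "finite {d. ?c d X \<noteq> 0}" using D finite_subset by blast
    have "(\<Sum>d\<in>?D. cochain_component m \<phi> d X) = \<phi> X" "(\<Sum>d\<in>?D. cochain_component m \<psi> d X) = \<psi> X"
      by (subst sum_support[OF D, symmetric]; auto simp flip: cochain_decomposition(3)[OF \<phi>]
          cochain_decomposition(3)[OF \<psi>])+
    then show "a *s \<phi> X + b *s \<psi> X = (\<Sum>d | ?c d X \<noteq> 0. ?c d X)"
      unfolding sum_support[OF D sub] by (simp add: sum.distrib flip: scale_sum_right)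
  qed
  let ?P = "\<lambda>d. differential_deg \<mu> m d (cochain_component m \<phi> d) X"
  let ?Q = "\<lambda>d. differential_deg \<mu> m d (cochain_component m \<psi> d) X"
  let ?D = "{d. ?P d \<noteq> 0} \<union> {d. ?Q d \<noteq> 0}"
  have D: "finite ?D" by (simp add: finite_\<delta>_part[OF \<mu>] \<phi> \<psi>)
  have PQ: "differential_deg \<mu> m d (?c d) X = a *s ?P d + b *s ?Q d" for d
    by (intro differential_deg_lincomb cochains_deg_cochain[OF \<mu>]
        cochains_deg_cochain[OF cochain_decomposition(1)] \<phi> \<psi>)
  have "differential \<mu> m (\<lambda>X. a *s \<phi> X + b *s \<psi> X) X = (\<Sum>d\<in>?D. a *s ?P d + b *s ?Q d)"
    unfolding differential_def comp PQ by (rule sum_support[OF D]) auto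
  also have "\<dots> = a *s (\<Sum>d\<in>?D. ?P d) + b *s (\<Sum>d\<in>?D. ?Q d)"
    by (simp add: sum.distrib scale_sum_right)
  also have "(\<Sum>d\<in>?D. ?P d) = differential \<mu> m \<phi> X"
    unfolding differential_def by (rule sum_support[OF D, symmetric]) auto
  also have "(\<Sum>d\<in>?D. ?Q d) = differential \<mu> m \<psi> X"
    unfolding differential_def by (rule sum_support[OF D, symmetric]) auto
  finally show ?thesis .
qed

text \<open>A homogeneous cochain is its own decomposition, concentrated in degree
  \<open>d\<close>.\<close>

lemma differential_homogeneous:
  assumes \<mu>: "\<mu> \<in> cochains 3" and \<phi>: "\<phi> \<in> cochains_deg m d"
  shows "differential \<mu> m \<phi> X = differential_deg \<mu> m d \<phi> X"
proof -
  let ?c = "\<lambda>e. if e = d then \<phi> else (\<lambda>X. 0)"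
  have zero: "(\<lambda>X. 0) \<in> cochains_deg m e" for e
    by (simp add: cochains_deg_iff subspace_0[OF subspace_homogeneous])
  have comp: "cochain_component m \<phi> = ?c"
  proof (rule cochain_component_eqI)
    fix X
    have sub: "{e. ?c e X \<noteq> 0} \<subseteq> {d}" by auto
    then show "finite {e. ?c e X \<noteq> 0}" by (rule finite_subset) simp
    show "\<phi> X = (\<Sum>e | ?c e X \<noteq> 0. ?c e X)"
      by (subst sum_support[OF _ sub]) simp_all
  qed (simp add: \<phi> zero)
  have "differential \<mu> m \<phi> X = (\<Sum>e\<in>{d}. differential_deg \<mu> m e (?c e) X)"
    unfolding differential_def comp
    by (rule sum_support) (auto simp: differential_deg_zero[OF \<mu>])
  then show ?thesis by simp
qed

end

section \<open>The suspension and the conclusion\<close>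

lemma graded_vector_space_suspension:
  assumes "graded_vector_space scale A"
  shows "graded_vector_space scale (suspension A)"
proof -
  interpret graded_vector_space scale A by fact
  show ?thesis
  proof
    show "subspace (suspension A n)" for n
      by (simp add: suspension_def subspace_homogeneous)
    fix x
    show "\<exists>!c. (\<forall>n. c n \<in> suspension A n) \<and> finite {n. c n \<noteq> 0} \<and> x = (\<Sum>n | c n \<noteq> 0. c n)"
    proof -
      let ?P = "\<lambda>W c. (\<forall>n. c n \<in> W n) \<and> finite {n. c n \<noteq> 0} \<and> x = (\<Sum>n | c n \<noteq> 0. c n)"
      \<comment> \<open>Shifting the index by one is a bijection between decompositions for the two
        gradings, so existence and uniqueness carry over from \<open>A\<close>.\<close>
      have shift: "?P (suspension A) c \<longleftrightarrow> ?P A (\<lambda>n. c (n + 1))" for c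
      proof -
        have S: "{n. c n \<noteq> 0} = (\<lambda>n. n + 1) ` {n. c (n + 1) \<noteq> 0}"
          by (auto intro!: image_eqI[of _ _ "_ - 1"])
        have "finite {n. c n \<noteq> 0} \<longleftrightarrow> finite {n. c (n + 1) \<noteq> 0}"
          unfolding S by (rule finite_image_iff) simp
        moreover have "(\<Sum>n | c n \<noteq> 0. c n) = (\<Sum>n | c (n + 1) \<noteq> 0. c (n + 1))"
          unfolding S by (subst sum.reindex) simp_all
        moreover have "(\<forall>n. c n \<in> suspension A n) \<longleftrightarrow> (\<forall>n. c (n + 1) \<in> A n)"
          unfolding suspension_def by (metis add_diff_cancel_right' diff_add_cancel)
        ultimately show ?thesis by simp
      qed
      obtain c where c: "?P A c" "\<And>c'. ?P A c' \<Longrightarrow> c' = c"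
        using direct_sum[of x] by metis
      show ?thesis
      proof (rule ex1I)
        show "?P (suspension A) (\<lambda>n. c (n - 1))"
          unfolding shift using c(1) by simp
        fix c' assume "?P (suspension A) c'"
        then have "(\<lambda>n. c' (n + 1)) = c" unfolding shift by (rule c(2))
        then show "c' = (\<lambda>n. c (n - 1))" by auto
      qed
    qed
  qed
qed

text \<open>The first three conjuncts certify that \<open>differential\<close> is the intended
  operator: it lands in arity \<open>m + 2\<close>, is linear, and has the prescribed values on
  homogeneous cochains. The fourth is the vanishing of its square.\<close>

theorem proposition3:
  fixes scale :: "'k::field_char_0 \<Rightarrow> 'a::ab_group_add \<Rightarrow> 'a"
    and A :: "int \<Rightarrow> 'a set"
    and \<mu> :: "('a list \<Rightarrow>\<^sub>0 'k) set \<Rightarrow> 'a"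
  assumes "graded_vector_space scale A"
    and "\<mu> \<in> graded_vector_space.cochains_deg scale (suspension A) 3 1"
    and "graded_vector_space.circ scale (suspension A) 3 3 1 \<mu> \<mu> = (\<lambda>X. 0)"
  shows
    "(\<forall>m. \<forall>\<phi>\<in>graded_vector_space.cochains scale m.
        graded_vector_space.differential scale (suspension A) \<mu> m \<phi>
          \<in> graded_vector_space.cochains scale (m + 2)) \<and>
     (\<forall>m. \<forall>\<phi>\<in>graded_vector_space.cochains scale m. \<forall>\<psi>\<in>graded_vector_space.cochains scale m. \<forall>a b.
        graded_vector_space.differential scale (suspension A) \<mu> m
            (\<lambda>X. scale a (\<phi> X) + scale b (\<psi> X)) =
          (\<lambda>X. scale a (graded_vector_space.differential scale (suspension A) \<mu> m \<phi> X)
             + scale b (graded_vector_space.differential scale (suspension A) \<mu> m \<psi> X))) \<and>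
     (\<forall>m d. \<forall>\<phi>\<in>graded_vector_space.cochains_deg scale (suspension A) m d.
        graded_vector_space.differential scale (suspension A) \<mu> m \<phi> =
          (\<lambda>X. graded_vector_space.circ scale (suspension A) 3 m d \<mu> \<phi> X
             - scale ((-1) powi d)
                 (graded_vector_space.circ scale (suspension A) m 3 1 \<phi> \<mu> X))) \<and>
     (\<forall>m. \<forall>\<phi>\<in>graded_vector_space.cochains scale m.
        graded_vector_space.differential scale (suspension A) \<mu> (m + 2)
          (graded_vector_space.differential scale (suspension A) \<mu> m \<phi>) = (\<lambda>X. 0))"
proof -
  interpret graded_vector_space scale "suspension A"
    by (rule graded_vector_space_suspension[OF assms(1)])
  note \<mu> = assms(2) cochains_deg_cochain[OF assms(2)]
  show ?thesis
    using differential_cochain[OF \<mu>(1)] differential_lincomb[OF \<mu>(1)]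
      differential_homogeneous[OF \<mu>(2)] differential_differential[OF \<mu>(1) _ assms(3)]
    by (auto simp: fun_eq_iff differential_deg_def)
qed

end
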